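(* Let $(E,\rho,[\cdot,\cdot]_E,L)$ be a regular local pre-Leibniz algebroid over $M$ with a locality projector $\mathcal{P}$, and let $\nabla$ be a linear $E$-connection. Then $(E,\rho,[\cdot,\cdot]_E^{\hat\nabla})$ is a pre-dull algebroid, where $[u,v]_E^{\hat\nabla}:=[u,v]_E-\mathcal{P}L(e^a,\nabla_{X_a}u,v)$. Moreover, if $\nabla$ is an admissible linear $E$-connection, then $(E,\rho,[\cdot,\cdot]_E^{\hat\nabla})$ is a pre-Lie algebroid.
   Context: Everything is smooth. $M$ is a manifold, $E\to M$ a real vector bundle of constant rank, $\mathfrak{X}(E)=\Gamma(E)$, $\Omega^1(E)=\Gamma(E^* )$. An anchored vector bundle $(E,\rho)$ has a vector bundle morphism $\rho:E\to T(M)$ over the identity; it is regular if $\ker\rho$ has locally constant rank. An almost-Leibniz algebroid $(E,\rho,[\cdot,\cdot]_E)$ is an anchored vector bundle with an $\mathbb{R}$-bilinear bracket on $\mathfrak{X}(E)$ satisfying $[u,fv]_E=\rho(u)(f)v+f[u,v]_E$; it is pre-Leibniz if moreover $\rho([u,v]_E)=[\rho(u),\rho(v)]$. It is local with locality operator $L$, a $C^\infty(M,\mathbb{R})$-multilinear map $L:\Omega^1(E)\times\mathfrak{X}(E)\times\mathfrak{X}(E)\to\mathfrak{X}(E)$, if $[fu,v]_E=-\rho(v)(f)u+f[u,v]_E+L(Df,u,v)$, where $(Df)(u):=\rho(u)(f)$. A locality projector is a $C^\infty(M,\mathbb{R})$-linear map $\mathcal{P}:\mathfrak{X}(E)\to\mathfrak{X}(E)$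 such that the image of $\mathcal{P}L$ lies in $\ker\rho$ and $\mathcal{P}$ restricts to the identity on $\ker\rho$. An almost-dull algebroid is an anchored vector bundle with a bracket satisfying $[f_1u,f_2v]=f_1f_2[u,v]+f_1\rho(u)(f_2)v-f_2\rho(v)(f_1)u$; it is pre-dull if moreover $\rho([u,v])=[\rho(u),\rho(v)]$. A pre-Lie algebroid is a pre-Leibniz algebroid with anti-symmetric bracket (no Jacobi identity is assumed). A linear $E$-connection is an $\mathbb{R}$-bilinear map $\nabla:\mathfrak{X}(E)\times\mathfrak{X}(E)\to\mathfrak{X}(E)$ with $\nabla_u(fv)=\rho(u)(f)v+f\nabla_uv$ and $\nabla_{fu}v=f\nabla_uv$. $(X_a)$ denotes a local frame of $E$, $(e^a)$ the dual coframe, repeated indices are summed; $L(e^a,\nabla_{X_a}u,v)$ does not depend on the frame. $\nabla$ is admissible if $[u,v]_E+[v,u]_E=L(e^a,\nabla_{X_a}u,v)+L(e^a,\nabla_{X_a}v,u)$ for all $u,v\in\mathfrak{X}(E)$. *)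

theory Defs
  imports "HOL-Analysis.Analysis" "HOL-Library.Function_Algebras"
begin

section \<open>Linear algebra and smooth maps between vector spaces\<close>

text \<open>
  Functions with values in a real vector space form a real vector space, pointwise.  (The additive
  structure and the pointwise product are those of \<^theory>\<open>HOL-Library.Function_Algebras\<close>.)
\<close>

instantiation "fun" :: (type, real_vector) real_vector
begin

definition scaleR_fun :: "real \<Rightarrow> ('a \<Rightarrow> 'b) \<Rightarrow> 'a \<Rightarrow> 'b"
  where "scaleR_fun c f = (\<lambda>x. c *\<^sub>R f x)"

instance
  by standard (auto simp: scaleR_fun_def fun_eq_iff scaleR_add_right scaleR_add_left)

end

text \<open>
  Model spaces (of manifolds and of fibres) are finite-dimensional types of class
  \<^class>\<open>real_inner\<close> rather than \<^class>\<open>euclidean_space\<close>, since the latter excludes dimension 0.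
\<close>

definition finite_dimensional_type :: "'a::real_vector itself \<Rightarrow> bool"
  where "finite_dimensional_type _ \<longleftrightarrow> (\<exists>B::'a set. finite B \<and> span B = UNIV)"

definition rlinear_on :: "'a::real_vector set \<Rightarrow> ('a \<Rightarrow> 'b::real_vector) \<Rightarrow> bool"
  where "rlinear_on S F \<longleftrightarrow>
    (\<forall>x\<in>S. \<forall>y\<in>S. F (x + y) = F x + F y) \<and> (\<forall>c. \<forall>x\<in>S. F (c *\<^sub>R x) = c *\<^sub>R F x)"

fun Ck_on :: "nat \<Rightarrow> 'a::real_normed_vector set \<Rightarrow> ('a \<Rightarrow> 'b::real_normed_vector) \<Rightarrow> bool"
  where
    "Ck_on 0 S f \<longleftrightarrow> continuous_on S f"
  | "Ck_on (Suc k) S f \<longleftrightarrow>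
      (\<forall>x\<in>S. f differentiable (at x)) \<and> (\<forall>v. Ck_on k S (\<lambda>x. frechet_derivative f (at x) v))"

text \<open>Smoothness on \<open>S\<close>; only used for open \<open>S\<close> in a finite-dimensional space.\<close>

definition Cinf_on :: "'a::real_normed_vector set \<Rightarrow> ('a \<Rightarrow> 'b::real_normed_vector) \<Rightarrow> bool"
  where "Cinf_on S f \<longleftrightarrow> (\<forall>k. Ck_on k S f)"

section \<open>Smooth manifolds\<close>

text \<open>
  The underlying topological space of a manifold is a type \<open>'m\<close>; the smooth structure is given by an
  atlas (not necessarily maximal) of charts \<open>(V, \<phi>)\<close>.  The values of \<open>\<phi>\<close> outside \<open>V\<close> are irrelevant.
\<close>

type_synonym ('m, 'a) atlas = "('m set \<times> ('m \<Rightarrow> 'a)) set"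

definition smooth_manifold ::
    "('m::{t2_space,second_countable_topology}, 'a::real_inner) atlas \<Rightarrow> bool"
  where "smooth_manifold A \<longleftrightarrow>
    finite_dimensional_type TYPE('a) \<and>
    (\<Union>(V, \<phi>)\<in>A. V) = UNIV \<and>
    (\<forall>(V, \<phi>)\<in>A. open V \<and> open (\<phi> ` V) \<and> homeomorphism V (\<phi> ` V) \<phi> (inv_into V \<phi>)) \<and>
    (\<forall>(V, \<phi>)\<in>A. \<forall>(V', \<phi>')\<in>A. Cinf_on (\<phi> ` (V \<inter> V')) (\<phi>' \<circ> inv_into V \<phi>))"

definition smooth_map_on ::
    "('m::topological_space, 'a::real_inner) atlas \<Rightarrow> 'm set \<Rightarrow> ('m \<Rightarrow> 'b::real_normed_vector) \<Rightarrow> bool"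
  where "smooth_map_on A U f \<longleftrightarrow>
    (\<forall>(V, \<phi>)\<in>A. Cinf_on (\<phi> ` (U \<inter> V)) (f \<circ> inv_into V \<phi>))"

definition smooth_functions :: "('m::topological_space, 'a::real_inner) atlas \<Rightarrow> ('m \<Rightarrow> real) set"
  where "smooth_functions A = {f. smooth_map_on A UNIV f}"

section \<open>Vector bundles\<close>

text \<open>
  The fibre over \<open>p\<close> is a linear subspace of an ambient real vector space \<open>'v\<close>, which carries no
  topology and may be infinite-dimensional.  This is no restriction: the fibres of any bundle embed
  in their direct sum.  The topology and the smooth structure of the total space are encoded by the
  local trivializations \<open>(U, \<Phi>)\<close>, where \<open>\<Phi> p\<close>, for \<open>p \<in> U\<close>, is a linear isomorphism from the fibre
  over \<open>p\<close> to the model fibre \<open>'k\<close>; its dimension is the rank.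
\<close>

record ('m, 'v, 'k) vbundle =
  fibre :: "'m \<Rightarrow> 'v set"
  trivs :: "('m set \<times> ('m \<Rightarrow> 'v \<Rightarrow> 'k)) set"

definition triv_inv :: "('m, 'v, 'k) vbundle \<Rightarrow> ('m \<Rightarrow> 'v \<Rightarrow> 'k) \<Rightarrow> 'm \<Rightarrow> 'k \<Rightarrow> 'v"
  where "triv_inv E \<Phi> p = inv_into (fibre E p) (\<Phi> p)"

definition vb_rank :: "('m, 'v, 'k::real_inner) vbundle \<Rightarrow> nat"
  where "vb_rank E = dim (UNIV :: 'k set)"

definition vector_bundle :: "('m::{t2_space,second_countable_topology}, 'a::real_inner) atlas \<Rightarrow>
    ('m, 'v::real_vector, 'k::real_inner) vbundle \<Rightarrow> bool"
  where "vector_bundle A E \<longleftrightarrow>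
    finite_dimensional_type TYPE('k) \<and>
    (\<forall>p. subspace (fibre E p)) \<and>
    (\<Union>(U, \<Phi>)\<in>trivs E. U) = UNIV \<and>
    (\<forall>(U, \<Phi>)\<in>trivs E. open U \<and>
      (\<forall>p\<in>U. rlinear_on (fibre E p) (\<Phi> p) \<and> bij_betw (\<Phi> p) (fibre E p) UNIV)) \<and>
    (\<forall>(U, \<Phi>)\<in>trivs E. \<forall>(U', \<Phi>')\<in>trivs E. \<forall>y.
      smooth_map_on A (U \<inter> U') (\<lambda>p. \<Phi>' p (triv_inv E \<Phi> p y)))"

definition sections :: "('m::topological_space, 'a::real_inner) atlas \<Rightarrow>
    ('m, 'v::real_vector, 'k::real_inner) vbundle \<Rightarrow> ('m \<Rightarrow> 'v) set"
  where "sections A E =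
    {s. (\<forall>p. s p \<in> fibre E p) \<and> (\<forall>(U, \<Phi>)\<in>trivs E. smooth_map_on A U (\<lambda>p. \<Phi> p (s p)))}"

definition smult :: "('m \<Rightarrow> real) \<Rightarrow> ('m \<Rightarrow> 'v::real_vector) \<Rightarrow> 'm \<Rightarrow> 'v"  (infixr "\<odot>" 75)
  where "f \<odot> s = (\<lambda>p. f p *\<^sub>R s p)"

text \<open>\<open>C\<^sup>\<infinity>(M)\<close>-linearity of a map between modules of sections \<open>S\<close> and \<open>T\<close>.\<close>

definition Cinf_linear :: "('m::topological_space, 'a::real_inner) atlas \<Rightarrow>
    ('m \<Rightarrow> 'v::real_vector) set \<Rightarrow> ('m \<Rightarrow> 'w::real_vector) set \<Rightarrow>
    (('m \<Rightarrow> 'v) \<Rightarrow> ('m \<Rightarrow> 'w)) \<Rightarrow> bool"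
  where "Cinf_linear A S T F \<longleftrightarrow>
    (\<forall>s\<in>S. F s \<in> T) \<and>
    (\<forall>s\<in>S. \<forall>t\<in>S. F (s + t) = F s + F t) \<and>
    (\<forall>f\<in>smooth_functions A. \<forall>s\<in>S. F (f \<odot> s) = f \<odot> F s)"

definition vb_morphism :: "('m::topological_space, 'a::real_inner) atlas \<Rightarrow>
    ('m, 'v::real_vector, 'k::real_inner) vbundle \<Rightarrow>
    ('m, 'w::real_vector, 'l::real_inner) vbundle \<Rightarrow> ('m \<Rightarrow> 'v \<Rightarrow> 'w) \<Rightarrow> bool"
  where "vb_morphism A E E' F \<longleftrightarrow>
    (\<forall>p. F p ` fibre E p \<subseteq> fibre E' p \<and> rlinear_on (fibre E p) (F p)) \<and>
    (\<forall>(U, \<Phi>)\<in>trivs E. \<forall>(U', \<Phi>')\<in>trivs E'. \<forall>y.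
      smooth_map_on A (U \<inter> U') (\<lambda>p. \<Phi>' p (F p (triv_inv E \<Phi> p y))))"

text \<open>
  The dual bundle: covectors at \<open>p\<close> vanish outside the fibre over \<open>p\<close>, so that they are determined by
  their values on it.  The inner product identifies the dual of the model fibre \<open>'k\<close> with \<open>'k\<close>.
\<close>

definition dual_bundle ::
    "('m, 'v::real_vector, 'k::real_inner) vbundle \<Rightarrow> ('m, 'v \<Rightarrow> real, 'k) vbundle"
  where "dual_bundle E =
    \<lparr> fibre = (\<lambda>p. {\<alpha>. rlinear_on (fibre E p) \<alpha> \<and> (\<forall>w. w \<notin> fibre E p \<longrightarrow> \<alpha> w = 0)}),
      trivs = (\<lambda>(U, \<Phi>). (U, \<lambda>p \<alpha>. THE k. \<forall>w\<in>fibre E p. \<alpha> w = k \<bullet> \<Phi> p w)) ` trivs E \<rparr>"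

abbreviation one_forms :: "('m::topological_space, 'a::real_inner) atlas \<Rightarrow>
    ('m, 'v::real_vector, 'k::real_inner) vbundle \<Rightarrow> ('m \<Rightarrow> 'v \<Rightarrow> real) set"
  where "one_forms A E \<equiv> sections A (dual_bundle E)"

text \<open>
  The tangent bundle: a tangent vector at \<open>p\<close> is a directional derivative operator at \<open>p\<close> on
  smooth functions (set to 0 on all other functions).
\<close>

definition chart_vector :: "('m::topological_space, 'a::real_inner) atlas \<Rightarrow>
    'm set \<Rightarrow> ('m \<Rightarrow> 'a) \<Rightarrow> 'm \<Rightarrow> 'a \<Rightarrow> ('m \<Rightarrow> real) \<Rightarrow> real"
  where "chart_vector A V \<phi> p w f =
    (if f \<in> smooth_functions A then frechet_derivative (f \<circ> inv_into V \<phi>) (at (\<phi> p)) w else 0)"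

definition tangent_bundle ::
    "('m::topological_space, 'a::real_inner) atlas \<Rightarrow> ('m, ('m \<Rightarrow> real) \<Rightarrow> real, 'a) vbundle"
  where "tangent_bundle A =
    \<lparr> fibre = (\<lambda>p. {chart_vector A V \<phi> p w | V \<phi> w. (V, \<phi>) \<in> A \<and> p \<in> V}),
      trivs = (\<lambda>(V, \<phi>). (V, \<lambda>p X. THE w. X = chart_vector A V \<phi> p w)) ` A \<rparr>"

definition lie_bracket :: "('m::topological_space, 'a::real_inner) atlas \<Rightarrow>
    ('m \<Rightarrow> ('m \<Rightarrow> real) \<Rightarrow> real) \<Rightarrow> ('m \<Rightarrow> ('m \<Rightarrow> real) \<Rightarrow> real) \<Rightarrow> 'm \<Rightarrow> ('m \<Rightarrow> real) \<Rightarrow> real"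
  where "lie_bracket A X Y = (\<lambda>p f.
    if f \<in> smooth_functions A then X p (\<lambda>q. Y q f) - Y p (\<lambda>q. X q f) else 0)"

section \<open>Anchored bundles and algebroids\<close>

text \<open>The tangent vector \<open>\<rho> p w\<close> is an operator on functions, so \<open>\<rho> p (u p) f\<close> is \<open>\<rho>(u)(f)\<close> at \<open>p\<close>.\<close>

type_synonym ('m, 'v) anchor = "'m \<Rightarrow> 'v \<Rightarrow> ('m \<Rightarrow> real) \<Rightarrow> real"
type_synonym ('m, 'v) bracket = "('m \<Rightarrow> 'v) \<Rightarrow> ('m \<Rightarrow> 'v) \<Rightarrow> 'm \<Rightarrow> 'v"
type_synonym ('m, 'v) locality = "('m \<Rightarrow> 'v \<Rightarrow> real) \<Rightarrow> ('m \<Rightarrow> 'v) \<Rightarrow> ('m \<Rightarrow> 'v) \<Rightarrow> 'm \<Rightarrow> 'v"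

definition anchor_sec :: "('m, 'v) anchor \<Rightarrow> ('m \<Rightarrow> 'v) \<Rightarrow> 'm \<Rightarrow> ('m \<Rightarrow> real) \<Rightarrow> real"
  where "anchor_sec \<rho> u = (\<lambda>p. \<rho> p (u p))"

definition anchor_der :: "('m, 'v) anchor \<Rightarrow> ('m \<Rightarrow> 'v) \<Rightarrow> ('m \<Rightarrow> real) \<Rightarrow> 'm \<Rightarrow> real"
  where "anchor_der \<rho> u f = (\<lambda>p. anchor_sec \<rho> u p f)"

definition coboundary ::
    "('m, 'v, 'k) vbundle \<Rightarrow> ('m, 'v) anchor \<Rightarrow> ('m \<Rightarrow> real) \<Rightarrow> 'm \<Rightarrow> 'v \<Rightarrow> real"
  where "coboundary E \<rho> f = (\<lambda>p w. if w \<in> fibre E p then \<rho> p w f else 0)"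

definition anchored_bundle :: "('m::{t2_space,second_countable_topology}, 'a::real_inner) atlas \<Rightarrow>
    ('m, 'v::real_vector, 'k::real_inner) vbundle \<Rightarrow> ('m, 'v) anchor \<Rightarrow> bool"
  where "anchored_bundle A E \<rho> \<longleftrightarrow>
    smooth_manifold A \<and> vector_bundle A E \<and> vb_morphism A E (tangent_bundle A) \<rho>"

definition regular_anchor ::
    "('m::topological_space, 'v::real_vector, 'k) vbundle \<Rightarrow> ('m, 'v) anchor \<Rightarrow> bool"
  where "regular_anchor E \<rho> \<longleftrightarrow>
    (\<forall>p. \<exists>U. open U \<and> p \<in> U \<and>
      (\<forall>q\<in>U. dim {w \<in> fibre E q. \<rho> q w = 0} = dim {w \<in> fibre E p. \<rho> p w = 0}))"

definition bilinear_bracket :: "('m::topological_space, 'a::real_inner) atlas \<Rightarrow>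
    ('m, 'v::real_vector, 'k::real_inner) vbundle \<Rightarrow> ('m, 'v) bracket \<Rightarrow> bool"
  where "bilinear_bracket A E br \<longleftrightarrow>
    (\<forall>u\<in>sections A E. \<forall>v\<in>sections A E. br u v \<in> sections A E) \<and>
    (\<forall>u\<in>sections A E. rlinear_on (sections A E) (\<lambda>v. br u v)) \<and>
    (\<forall>v\<in>sections A E. rlinear_on (sections A E) (\<lambda>u. br u v))"

definition bracket_morphism :: "('m::topological_space, 'a::real_inner) atlas \<Rightarrow>
    ('m, 'v::real_vector, 'k::real_inner) vbundle \<Rightarrow> ('m, 'v) anchor \<Rightarrow> ('m, 'v) bracket \<Rightarrow> bool"
  where "bracket_morphism A E \<rho> br \<longleftrightarrow>
    (\<forall>u\<in>sections A E. \<forall>v\<in>sections A E.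
      anchor_sec \<rho> (br u v) = lie_bracket A (anchor_sec \<rho> u) (anchor_sec \<rho> v))"

definition almost_Leibniz :: "('m::{t2_space,second_countable_topology}, 'a::real_inner) atlas \<Rightarrow>
    ('m, 'v::real_vector, 'k::real_inner) vbundle \<Rightarrow> ('m, 'v) anchor \<Rightarrow> ('m, 'v) bracket \<Rightarrow> bool"
  where "almost_Leibniz A E \<rho> br \<longleftrightarrow>
    anchored_bundle A E \<rho> \<and> bilinear_bracket A E br \<and>
    (\<forall>u\<in>sections A E. \<forall>v\<in>sections A E. \<forall>f\<in>smooth_functions A.
      br u (f \<odot> v) = anchor_der \<rho> u f \<odot> v + f \<odot> br u v)"

definition pre_Leibniz :: "('m::{t2_space,second_countable_topology}, 'a::real_inner) atlas \<Rightarrow>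
    ('m, 'v::real_vector, 'k::real_inner) vbundle \<Rightarrow> ('m, 'v) anchor \<Rightarrow> ('m, 'v) bracket \<Rightarrow> bool"
  where "pre_Leibniz A E \<rho> br \<longleftrightarrow> almost_Leibniz A E \<rho> br \<and> bracket_morphism A E \<rho> br"

definition locality_operator :: "('m::{t2_space,second_countable_topology}, 'a::real_inner) atlas \<Rightarrow>
    ('m, 'v::real_vector, 'k::real_inner) vbundle \<Rightarrow> ('m, 'v) anchor \<Rightarrow> ('m, 'v) bracket \<Rightarrow>
    ('m, 'v) locality \<Rightarrow> bool"
  where "locality_operator A E \<rho> br L \<longleftrightarrow>
    (\<forall>u\<in>sections A E. \<forall>v\<in>sections A E.
      Cinf_linear A (one_forms A E) (sections A E) (\<lambda>\<omega>. L \<omega> u v)) \<and>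
    (\<forall>\<omega>\<in>one_forms A E. \<forall>v\<in>sections A E.
      Cinf_linear A (sections A E) (sections A E) (\<lambda>u. L \<omega> u v)) \<and>
    (\<forall>\<omega>\<in>one_forms A E. \<forall>u\<in>sections A E.
      Cinf_linear A (sections A E) (sections A E) (\<lambda>v. L \<omega> u v)) \<and>
    (\<forall>u\<in>sections A E. \<forall>v\<in>sections A E. \<forall>f\<in>smooth_functions A.
      br (f \<odot> u) v = - (anchor_der \<rho> v f \<odot> u) + f \<odot> br u v + L (coboundary E \<rho> f) u v)"

definition local_pre_Leibniz :: "('m::{t2_space,second_countable_topology}, 'a::real_inner) atlas \<Rightarrow>
    ('m, 'v::real_vector, 'k::real_inner) vbundle \<Rightarrow> ('m, 'v) anchor \<Rightarrow> ('m, 'v) bracket \<Rightarrow>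
    ('m, 'v) locality \<Rightarrow> bool"
  where "local_pre_Leibniz A E \<rho> br L \<longleftrightarrow>
    pre_Leibniz A E \<rho> br \<and> locality_operator A E \<rho> br L"

definition locality_projector :: "('m::topological_space, 'a::real_inner) atlas \<Rightarrow>
    ('m, 'v::real_vector, 'k::real_inner) vbundle \<Rightarrow> ('m, 'v) anchor \<Rightarrow> ('m, 'v) locality \<Rightarrow>
    (('m \<Rightarrow> 'v) \<Rightarrow> 'm \<Rightarrow> 'v) \<Rightarrow> bool"
  where "locality_projector A E \<rho> L P \<longleftrightarrow>
    Cinf_linear A (sections A E) (sections A E) P \<and>
    (\<forall>\<omega>\<in>one_forms A E. \<forall>u\<in>sections A E. \<forall>v\<in>sections A E. anchor_sec \<rho> (P (L \<omega> u v)) = 0) \<and>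
    (\<forall>u\<in>sections A E. anchor_sec \<rho> u = 0 \<longrightarrow> P u = u)"

definition almost_dull :: "('m::{t2_space,second_countable_topology}, 'a::real_inner) atlas \<Rightarrow>
    ('m, 'v::real_vector, 'k::real_inner) vbundle \<Rightarrow> ('m, 'v) anchor \<Rightarrow> ('m, 'v) bracket \<Rightarrow> bool"
  where "almost_dull A E \<rho> br \<longleftrightarrow>
    anchored_bundle A E \<rho> \<and> bilinear_bracket A E br \<and>
    (\<forall>u\<in>sections A E. \<forall>v\<in>sections A E. \<forall>f\<^sub>1\<in>smooth_functions A. \<forall>f\<^sub>2\<in>smooth_functions A.
      br (f\<^sub>1 \<odot> u) (f\<^sub>2 \<odot> v) =
        (f\<^sub>1 * f\<^sub>2) \<odot> br u v + (f\<^sub>1 * anchor_der \<rho> u f\<^sub>2) \<odot> v - (f\<^sub>2 * anchor_der \<rho> v f\<^sub>1) \<odot> u)"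

definition pre_dull :: "('m::{t2_space,second_countable_topology}, 'a::real_inner) atlas \<Rightarrow>
    ('m, 'v::real_vector, 'k::real_inner) vbundle \<Rightarrow> ('m, 'v) anchor \<Rightarrow> ('m, 'v) bracket \<Rightarrow> bool"
  where "pre_dull A E \<rho> br \<longleftrightarrow> almost_dull A E \<rho> br \<and> bracket_morphism A E \<rho> br"

definition pre_Lie :: "('m::{t2_space,second_countable_topology}, 'a::real_inner) atlas \<Rightarrow>
    ('m, 'v::real_vector, 'k::real_inner) vbundle \<Rightarrow> ('m, 'v) anchor \<Rightarrow> ('m, 'v) bracket \<Rightarrow> bool"
  where "pre_Lie A E \<rho> br \<longleftrightarrow> pre_Leibniz A E \<rho> br \<and>
    (\<forall>u\<in>sections A E. \<forall>v\<in>sections A E. br u v = - br v u)"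

section \<open>Connections and the modified bracket\<close>

text \<open>\<open>nab u v\<close> stands for the covariant derivative of \<open>v\<close> along \<open>u\<close>.\<close>

definition linear_connection :: "('m::topological_space, 'a::real_inner) atlas \<Rightarrow>
    ('m, 'v::real_vector, 'k::real_inner) vbundle \<Rightarrow> ('m, 'v) anchor \<Rightarrow> ('m, 'v) bracket \<Rightarrow> bool"
  where "linear_connection A E \<rho> nab \<longleftrightarrow>
    bilinear_bracket A E nab \<and>
    (\<forall>u\<in>sections A E. \<forall>v\<in>sections A E. \<forall>f\<in>smooth_functions A.
      nab u (f \<odot> v) = anchor_der \<rho> u f \<odot> v + f \<odot> nab u v \<and>
      nab (f \<odot> u) v = f \<odot> nab u v)"

text \<open>
  \<open>X\<close> and \<open>e\<close> are global smooth sections whose restrictions to the open set \<open>U\<close> are a local frame of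
  the bundle and its dual coframe.
\<close>

definition frame_coframe_on :: "('m::topological_space, 'a::real_inner) atlas \<Rightarrow>
    ('m, 'v::real_vector, 'k::real_inner) vbundle \<Rightarrow> 'm set \<Rightarrow>
    (nat \<Rightarrow> 'm \<Rightarrow> 'v) \<Rightarrow> (nat \<Rightarrow> 'm \<Rightarrow> 'v \<Rightarrow> real) \<Rightarrow> bool"
  where "frame_coframe_on A E U X e \<longleftrightarrow>
    open U \<and>
    (\<forall>a<vb_rank E. X a \<in> sections A E \<and> e a \<in> one_forms A E) \<and>
    (\<forall>p\<in>U. inj_on (\<lambda>a. X a p) {..<vb_rank E} \<and>
      independent ((\<lambda>a. X a p) ` {..<vb_rank E}) \<and>
      span ((\<lambda>a. X a p) ` {..<vb_rank E}) = fibre E p) \<and>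
    (\<forall>p\<in>U. \<forall>a<vb_rank E. \<forall>b<vb_rank E. e a p (X b p) = (if a = b then 1 else 0))"

text \<open>
  The section \<open>L(e\<^sup>a, \<nabla>\<^bsub>X\<^sub>a\<^esub> u, v)\<close>.  Near any point, a local frame and its dual coframe coincide with global
  sections (by multiplication with a cutoff function), and the value at the point does not depend on
  the choices made, \<open>L\<close> and \<open>\<nabla>\<close> being \<open>C\<^sup>\<infinity>(M)\<close>-linear, hence local, in the slots concerned.
\<close>

definition frame_contraction :: "('m::topological_space, 'a::real_inner) atlas \<Rightarrow>
    ('m, 'v::real_vector, 'k::real_inner) vbundle \<Rightarrow> ('m, 'v) locality \<Rightarrow> ('m, 'v) bracket \<Rightarrow>
    ('m \<Rightarrow> 'v) \<Rightarrow> ('m \<Rightarrow> 'v) \<Rightarrow> 'm \<Rightarrow> 'v"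
  where "frame_contraction A E L nab u v = (\<lambda>p. THE w.
    \<exists>U X e. p \<in> U \<and> frame_coframe_on A E U X e \<and>
      w = (\<Sum>a<vb_rank E. L (e a) (nab (X a) u) v p))"

definition admissible_connection :: "('m::topological_space, 'a::real_inner) atlas \<Rightarrow>
    ('m, 'v::real_vector, 'k::real_inner) vbundle \<Rightarrow> ('m, 'v) bracket \<Rightarrow> ('m, 'v) locality \<Rightarrow>
    ('m, 'v) bracket \<Rightarrow> bool"
  where "admissible_connection A E br L nab \<longleftrightarrow>
    (\<forall>u\<in>sections A E. \<forall>v\<in>sections A E.
      br u v + br v u = frame_contraction A E L nab u v + frame_contraction A E L nab v u)"

definition modified_bracket :: "('m::topological_space, 'a::real_inner) atlas \<Rightarrow>
    ('m, 'v::real_vector, 'k::real_inner) vbundle \<Rightarrow> ('m, 'v) bracket \<Rightarrow> ('m, 'v) locality \<Rightarrow>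
    (('m \<Rightarrow> 'v) \<Rightarrow> 'm \<Rightarrow> 'v) \<Rightarrow> ('m, 'v) bracket \<Rightarrow> ('m, 'v) bracket"
  where "modified_bracket A E br L P nab = (\<lambda>u v. br u v - P (frame_contraction A E L nab u v))"

end

(*
  Let C(u,v) = L(e^a, nabla_{X_a} u, v).  The Leibniz rule of nabla and rho(X_a)(f) e^a = Df give
  C(fu, v) = f C(u,v) + L(Df,u,v), so subtracting C would cancel the anomalous term of [fu, v].
  Applying rho to the locality equation shows that L(Df,u,v) lies in ker rho, hence is fixed by P,
  so subtracting P C cancels it as well; and rho P C = 0 leaves rho([u,v]) unchanged.  For an
  admissible connection the symmetric part of [u,v] is that of C and lies in ker rho, hence it
  equals the symmetric part of P C.

  The analytic input is that C makes sense as a smooth section: bump functions extend local frames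
  and their coframes to global sections, and make maps that are linear over smooth functions local.
*)
theory Submission
  imports Defs
begin

section \<open>Smooth maps between vector spaces\<close>

text \<open>Subtracting C itself could spoil the morphism property: every Df vanishes on ker rho, so
  the locality equation controls rho L(Df,u,v) but says nothing about rho L(e^a,...) for a full
  coframe. The projector forces this uncontrolled part into ker rho and leaves L(Df,u,v) alone. The
  formal obstacle is the passage between local and global. \<open>L\<close>, \<open>nab\<close> and
  \<open>P\<close> act on global sections, tangent vectors act on globally smooth functions, but
  frames exist only locally; so a pointwise formula is reached through a global section that agrees
  with the wanted one near the point. The cutoffs behind this are extended by zero, which is safe
  because coordinate balls are compact and the manifold is Hausdorff.\<close>

lemma Ck_on_cong:
  assumes "open S" and "\<And>x. x \<in> S \<Longrightarrow> f x = g x"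
  shows "Ck_on k S f \<longleftrightarrow> Ck_on k S g"
proof -
  have *: "Ck_on k S g" if "Ck_on k S f" "\<And>x. x \<in> S \<Longrightarrow> f x = g x" for f g :: "'a \<Rightarrow> 'b"
    using that
  proof (induction k arbitrary: f g)
    case 0
    then show ?case by (metis Ck_on.simps(1) continuous_on_cong)
  next
    case (Suc k)
    have d: "(f has_derivative D) (at x) \<Longrightarrow> (g has_derivative D) (at x)" if "x \<in> S" for x D
      using has_derivative_transform_within_open[of f D x UNIV S g] that assms(1) Suc.prems(2) by auto
    have e: "frechet_derivative f (at x) = frechet_derivative g (at x)" if "x \<in> S" for x
      using d[OF that] Suc.prems(1) that frechet_derivative_at
      by (metis Ck_on.simps(2) frechet_derivative_works)
    have "Ck_on k S (\<lambda>x. frechet_derivative g (at x) v)" for v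
      using Suc.IH[of "\<lambda>x. frechet_derivative f (at x) v"] e Suc.prems(1) by simp
    moreover have "g differentiable (at x)" if "x \<in> S" for x
      using d[OF that] Suc.prems(1) that by (meson Ck_on.simps(2) differentiable_def)
    ultimately show ?case by simp
  qed
  show ?thesis using *[of f g] *[of g f] assms(2) by auto
qed

text \<open>\<open>frechet_derivative\<close> is a choice term; here any explicitly known derivative
  may stand in for it. The two agree only on \<open>S\<close>, so openness is needed to pass from
  one to the other at the next order.\<close>

lemma Ck_on_SucI:
  assumes "open S" and "\<And>x. x \<in> S \<Longrightarrow> (f has_derivative f' x) (at x)"
    and "\<And>v. Ck_on k S (\<lambda>x. f' x v)"
  shows "Ck_on (Suc k) S f"
proof -
  have "Ck_on k S (\<lambda>x. frechet_derivative f (at x) v)" for v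
    using Ck_on_cong[OF assms(1), of "\<lambda>x. frechet_derivative f (at x) v" "\<lambda>x. f' x v" k]
      frechet_derivative_at[OF assms(2)] assms(3) by auto
  then show ?thesis using assms(2) by (auto simp: differentiable_def)
qed

lemma Ck_on_has_derivative:
  "Ck_on (Suc k) S f \<Longrightarrow> x \<in> S \<Longrightarrow> (f has_derivative frechet_derivative f (at x)) (at x)"
  using frechet_derivative_works by auto

lemma Ck_on_Suc_imp: "Ck_on (Suc k) S f \<Longrightarrow> Ck_on k S f"
proof (induction k arbitrary: f)
  case 0
  then show ?case
    by (simp add: differentiable_imp_continuous_within continuous_at_imp_continuous_on)
next
  case (Suc k)
  then show ?case by (metis Ck_on.simps(2))
qed

lemma Ck_on_subset: "Ck_on k S f \<Longrightarrow> T \<subseteq> S \<Longrightarrow> Ck_on k T f"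
  by (induction k arbitrary: f) (auto intro: continuous_on_subset)

lemma Ck_on_local:
  assumes "\<And>x. x \<in> S \<Longrightarrow> \<exists>T. open T \<and> x \<in> T \<and> Ck_on k T f"
  shows "Ck_on k S f"
  using assms
proof (induction k arbitrary: f)
  case 0
  then have "continuous (at x) f" if "x \<in> S" for x
    using that continuous_on_eq_continuous_at by (metis Ck_on.simps(1))
  then show ?case by (simp add: continuous_at_imp_continuous_on)
next
  case (Suc k)
  have "f differentiable (at x)" if "x \<in> S" for x
    using Suc.prems[OF that] by auto
  moreover have "Ck_on k S (\<lambda>x. frechet_derivative f (at x) v)" for v
    using Suc.prems by (intro Suc.IH) (metis Ck_on.simps(2))
  ultimately show ?case by simp
qed

lemma Ck_on_const: "Ck_on k S (\<lambda>x. c)"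
  by (induction k arbitrary: c) (auto simp: frechet_derivative_const)

lemma Ck_on_bounded_linear:
  assumes "bounded_linear h" "open S" "Ck_on k S f"
  shows "Ck_on k S (\<lambda>x. h (f x))"
  using assms(3)
proof (induction k arbitrary: f)
  case 0
  then show ?case using assms(1) by (simp add: bounded_linear.continuous_on)
next
  case (Suc k)
  show ?case
  proof (rule Ck_on_SucI[OF assms(2)])
    show "((\<lambda>x. h (f x)) has_derivative (\<lambda>v. h (frechet_derivative f (at x) v))) (at x)" if "x \<in> S" for x
      using bounded_linear.has_derivative[OF assms(1) Ck_on_has_derivative[OF Suc.prems that]] .
    show "Ck_on k S (\<lambda>x. h (frechet_derivative f (at x) v))" for v
      using Suc by auto
  qed
qed

lemma Ck_on_add:
  assumes "open S" "Ck_on k S f" "Ck_on k S g"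
  shows "Ck_on k S (\<lambda>x. f x + g x)"
  using assms(2,3)
proof (induction k arbitrary: f g)
  case 0
  then show ?case by (simp add: continuous_on_add)
next
  case (Suc k)
  show ?case
  proof (rule Ck_on_SucI[OF assms(1)])
    show "((\<lambda>x. f x + g x) has_derivative
        (\<lambda>v. frechet_derivative f (at x) v + frechet_derivative g (at x) v)) (at x)" if "x \<in> S" for x
      by (intro has_derivative_add Suc.prems[THEN Ck_on_has_derivative, OF that])
    show "Ck_on k S (\<lambda>x. frechet_derivative f (at x) v + frechet_derivative g (at x) v)" for v
      using Suc by auto
  qed
qed

text \<open>An arbitrary bounded bilinear product covers multiplication, scaling and inner product
  at once. The derivative still contains the undifferentiated factors, which is why
  \<open>Ck_on_Suc_imp\<close> is used.\<close>

lemma Ck_on_bilinear: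
  assumes "bounded_bilinear pr" "open S" "Ck_on k S f" "Ck_on k S g"
  shows "Ck_on k S (\<lambda>x. pr (f x) (g x))"
  using assms(3,4)
proof (induction k arbitrary: f g)
  case 0
  then show ?case using assms(1) by (simp add: bounded_bilinear.continuous_on)
next
  case (Suc k)
  show ?case
  proof (rule Ck_on_SucI[OF assms(2)])
    show "((\<lambda>x. pr (f x) (g x)) has_derivative
        (\<lambda>v. pr (f x) (frechet_derivative g (at x) v) + pr (frechet_derivative f (at x) v) (g x))) (at x)"
      if "x \<in> S" for x
      by (intro bounded_bilinear.FDERIV[OF assms(1)] Suc.prems[THEN Ck_on_has_derivative, OF that])
    show "Ck_on k S (\<lambda>x. pr (f x) (frechet_derivative g (at x) v) + pr (frechet_derivative f (at x) v) (g x))" for v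
      using Suc.prems
      by (intro Ck_on_add[OF assms(2)] Suc.IH Suc.prems[THEN Ck_on_Suc_imp]) auto
  qed
qed

lemma Ck_on_sum:
  assumes "open S" "\<And>i. i \<in> I \<Longrightarrow> Ck_on k S (f i)"
  shows "Ck_on k S (\<lambda>x. \<Sum>i\<in>I. f i x)"
  using assms(2)
  by (induction I rule: infinite_finite_induct) (auto simp: Ck_on_const Ck_on_add[OF assms(1)])

text \<open>The derivative is a constant times the square of the function itself, so the induction
  closes by the product rule.\<close>

lemma Ck_on_inverse:
  assumes "open S" "0 \<notin> S"
  shows "Ck_on k S (inverse :: real \<Rightarrow> real)"
proof (induction k)
  case 0
  show ?case using assms(2) by (auto intro!: continuous_intros)
next
  case (Suc k)
  show ?case
  proof (rule Ck_on_SucI[OF assms(1)])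
    show "(inverse has_derivative (\<lambda>h. - (inverse x * h * inverse x))) (at x)" if "x \<in> S" for x :: real
      using that assms(2) by (intro has_derivative_inverse') auto
    have "Ck_on k S (\<lambda>x. (- v) * (inverse x * inverse x))" for v :: real
      by (intro Ck_on_bilinear[OF bounded_bilinear_mult assms(1)] Suc Ck_on_const)
    then show "Ck_on k S (\<lambda>x. - (inverse x * v * inverse x))" for v :: real
      by (simp add: mult.commute mult.left_commute)
  qed
qed

text \<open>Plays the role of \<open>Basis\<close> for model spaces that may have dimension 0, where
  it is the empty set. The expansion property is part of the notion because it is what the
  coordinate arguments use.\<close>

definition orthonormal_basis :: "'a::real_inner set \<Rightarrow> bool"
  where "orthonormal_basis B \<longleftrightarrow> finite B \<and>
    (\<forall>b\<in>B. \<forall>c\<in>B. b \<bullet> c = (if b = c then 1 else 0)) \<and> (\<forall>x. (\<Sum>b\<in>B. (x \<bullet> b) *\<^sub>R b) = x)"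

lemma finite_dimensional_orthonormal_basis:
  assumes "finite_dimensional_type TYPE('a::real_inner)"
  obtains B :: "'a::real_inner set" where "orthonormal_basis B"
proof -
  obtain B0 :: "'a set" where "finite B0" "span B0 = UNIV"
    using assms by (auto simp: finite_dimensional_type_def)
  then obtain C :: "'a set" where C: "finite C" "span C = UNIV" "pairwise orthogonal C"
    using basis_orthogonal[of B0] by auto
  \<comment> \<open>An orthogonal spanning set may contain 0, which cannot be normalised.\<close>
  define B where "B = (\<lambda>c. c /\<^sub>R norm c) ` (C - {0})"
  have fB: "finite B" using C(1) by (simp add: B_def)
  have n: "b \<bullet> b = 1" if "b \<in> B" for b
  proof -
    obtain c where "c \<noteq> 0" "b = c /\<^sub>R norm c" using \<open>b \<in> B\<close> by (auto simp: B_def)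
    then have "norm b = 1" by simp
    then show ?thesis by (simp add: dot_square_norm)
  qed
  have o: "b \<bullet> c = 0" if "b \<in> B" "c \<in> B" "b \<noteq> c" for b c
  proof -
    obtain x y where x: "x \<in> C" "b = x /\<^sub>R norm x" and y: "y \<in> C" "c = y /\<^sub>R norm y"
      using \<open>b \<in> B\<close> \<open>c \<in> B\<close> by (auto simp: B_def)
    then have "x \<noteq> y" using that by auto
    then have "x \<bullet> y = 0" using C(3) x y by (auto simp: pairwise_def orthogonal_def)
    then show ?thesis by (simp add: x y)
  qed
  have "c \<in> span B" if "c \<in> C" for c
  proof (cases "c = 0")
    case False
    then have "c /\<^sub>R norm c \<in> B" using that by (auto simp: B_def)
    then have "norm c *\<^sub>R (c /\<^sub>R norm c) \<in> span B" by (intro span_scale span_base)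
    then show ?thesis using False by simp
  qed (simp add: span_zero)
  then have "span C \<subseteq> span B" by (intro span_minimal) auto
  then have sp: "x \<in> span B" for x using C by auto
  have "(\<Sum>b\<in>B. (x \<bullet> b) *\<^sub>R b) = x" for x
  proof -
    obtain u where u: "x = (\<Sum>b\<in>B. u b *\<^sub>R b)"
      using sp[of x] by (auto simp: span_finite[OF fB])
    have "x \<bullet> b = u b" if "b \<in> B" for b
    proof -
      have "x \<bullet> b = (\<Sum>c\<in>B. u c * (c \<bullet> b))" unfolding u by (simp add: inner_sum_left)
      also have "\<dots> = (\<Sum>c\<in>B. if c = b then u b else 0)"
        by (intro sum.cong) (auto simp: n o that)
      finally show ?thesis using fB that by simp
    qed
    then have "(\<Sum>b\<in>B. (x \<bullet> b) *\<^sub>R b) = (\<Sum>b\<in>B. u b *\<^sub>R b)" by (intro sum.cong) auto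
    then show ?thesis using u by simp
  qed
  then show thesis using that[of B] fB n o by (simp add: orthonormal_basis_def)
qed

text \<open>The recursion of \<open>Ck_on\<close> differentiates in a fixed direction, while the
  chain rule evaluates Dg at f(x) in the moving direction Df(x)v. Expanding this direction in an
  orthonormal basis of the middle space leaves sums of products of fixed-direction derivatives;
  hence its finite dimension, and an induction in which \<open>g\<close> varies.\<close>

lemma Ck_on_compose:
  fixes f :: "'a::real_normed_vector \<Rightarrow> 'b::real_inner" and g :: "'b \<Rightarrow> 'c::real_normed_vector"
  assumes "finite_dimensional_type TYPE('b)" "open S" "f ` S \<subseteq> T"
    and "Ck_on k T g" "Ck_on k S f"
  shows "Ck_on k S (\<lambda>x. g (f x))"
  using assms(4,5)
proof (induction k arbitrary: g)
  case 0
  then show ?case using assms(3) by (auto intro: continuous_on_compose2)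
next
  case (Suc k)
  obtain B :: "'b set" where B: "orthonormal_basis B"
    using finite_dimensional_orthonormal_basis[OF assms(1)] .
  let ?Df = "\<lambda>x. frechet_derivative f (at x)" and ?Dg = "\<lambda>y. frechet_derivative g (at y)"
  show ?case
  proof (rule Ck_on_SucI[OF assms(2)])
    fix x assume x: "x \<in> S"
    have g: "(g has_derivative ?Dg (f x)) (at (f x))"
      using Ck_on_has_derivative[OF Suc.prems(1)] x assms(3) by auto
    have "((\<lambda>x. g (f x)) has_derivative (\<lambda>v. ?Dg (f x) (?Df x v))) (at x)"
      using has_derivative_compose[OF Ck_on_has_derivative[OF Suc.prems(2) x] g] .
    moreover have "?Dg (f x) y = (\<Sum>b\<in>B. (y \<bullet> b) *\<^sub>R ?Dg (f x) b)" for y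
    proof -
      have "linear (?Dg (f x))" using g has_derivative_linear by blast
      then have "?Dg (f x) (\<Sum>b\<in>B. (y \<bullet> b) *\<^sub>R b) = (\<Sum>b\<in>B. (y \<bullet> b) *\<^sub>R ?Dg (f x) b)"
        by (simp add: linear_sum linear_cmul)
      then show ?thesis using B by (simp add: orthonormal_basis_def)
    qed
    ultimately show "((\<lambda>x. g (f x)) has_derivative
        (\<lambda>v. \<Sum>b\<in>B. (?Df x v \<bullet> b) *\<^sub>R ?Dg (f x) b)) (at x)"
      by (rule has_derivative_eq_rhs[OF _ ext])
  next
    fix v
    have "Ck_on k S (\<lambda>x. (?Df x v \<bullet> b) *\<^sub>R ?Dg (f x) b)" for b
    proof (intro Ck_on_bilinear[OF bounded_bilinear_scaleR assms(2)])
      show "Ck_on k S (\<lambda>x. ?Df x v \<bullet> b)"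
        using Suc.prems by (intro Ck_on_bounded_linear[OF bounded_linear_inner_left assms(2)]) auto
      show "Ck_on k S (\<lambda>x. ?Dg (f x) b)"
        using Suc.prems by (intro Suc.IH[of "\<lambda>y. ?Dg y b"] Ck_on_Suc_imp[of k S f]) simp_all
    qed
    then show "Ck_on k S (\<lambda>x. \<Sum>b\<in>B. (?Df x v \<bullet> b) *\<^sub>R ?Dg (f x) b)"
      by (intro Ck_on_sum[OF assms(2)])
  qed
qed

lemma Cinf_on_cong:
  "open S \<Longrightarrow> (\<And>x. x \<in> S \<Longrightarrow> f x = g x) \<Longrightarrow> Cinf_on S f \<longleftrightarrow> Cinf_on S g"
  using Ck_on_cong[of S f g] by (simp add: Cinf_on_def)

lemma Cinf_on_subset: "Cinf_on S f \<Longrightarrow> T \<subseteq> S \<Longrightarrow> Cinf_on T f"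
  using Ck_on_subset unfolding Cinf_on_def by blast

lemma Cinf_on_local:
  assumes "\<And>x. x \<in> S \<Longrightarrow> \<exists>T. open T \<and> x \<in> T \<and> Cinf_on T f"
  shows "Cinf_on S f"
  unfolding Cinf_on_def
proof
  fix k
  show "Ck_on k S f" by (rule Ck_on_local) (use assms in \<open>auto simp: Cinf_on_def\<close>)
qed

lemma Cinf_on_const: "Cinf_on S (\<lambda>x. c)"
  by (simp add: Cinf_on_def Ck_on_const)

lemma Cinf_on_id: assumes "open S" shows "Cinf_on S (\<lambda>x. x)"
proof -
  have "Ck_on k S (\<lambda>x. x)" for k
  proof (cases k)
    case (Suc j)
    then show ?thesis using assms
      by (auto intro!: Ck_on_SucI[where f' = "\<lambda>x v. v"] Ck_on_const simp del: Ck_on.simps(2))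
  qed auto
  then show ?thesis by (simp add: Cinf_on_def)
qed

lemma Cinf_on_bounded_linear:
  "bounded_linear h \<Longrightarrow> open S \<Longrightarrow> Cinf_on S f \<Longrightarrow> Cinf_on S (\<lambda>x. h (f x))"
  by (simp add: Cinf_on_def Ck_on_bounded_linear)

lemma Cinf_on_add: "open S \<Longrightarrow> Cinf_on S f \<Longrightarrow> Cinf_on S g \<Longrightarrow> Cinf_on S (\<lambda>x. f x + g x)"
  by (simp add: Cinf_on_def Ck_on_add)

lemma Cinf_on_bilinear:
  "bounded_bilinear pr \<Longrightarrow> open S \<Longrightarrow> Cinf_on S f \<Longrightarrow> Cinf_on S g \<Longrightarrow> Cinf_on S (\<lambda>x. pr (f x) (g x))"
  by (simp add: Cinf_on_def Ck_on_bilinear)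

lemma Cinf_on_sum:
  "open S \<Longrightarrow> (\<And>i. i \<in> I \<Longrightarrow> Cinf_on S (f i)) \<Longrightarrow> Cinf_on S (\<lambda>x. \<Sum>i\<in>I. f i x)"
  by (simp add: Cinf_on_def Ck_on_sum)

lemma Cinf_on_compose:
  fixes f :: "'a::real_normed_vector \<Rightarrow> 'b::real_inner" and g :: "'b \<Rightarrow> 'c::real_normed_vector"
  assumes "finite_dimensional_type TYPE('b)" "open S" "f ` S \<subseteq> T" "Cinf_on T g" "Cinf_on S f"
  shows "Cinf_on S (\<lambda>x. g (f x))"
  using assms Ck_on_compose unfolding Cinf_on_def by blast

lemma Cinf_on_has_derivative:
  "Cinf_on S f \<Longrightarrow> x \<in> S \<Longrightarrow> (f has_derivative frechet_derivative f (at x)) (at x)"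
  using Ck_on_has_derivative unfolding Cinf_on_def by blast

lemma Cinf_on_frechet_derivative:
  assumes "Cinf_on S f"
  shows "Cinf_on S (\<lambda>x. frechet_derivative f (at x) v)"
  unfolding Cinf_on_def
proof
  fix k
  have "Ck_on (Suc k) S f" using assms Cinf_on_def by blast
  then show "Ck_on k S (\<lambda>x. frechet_derivative f (at x) v)" by simp
qed

section \<open>Flat functions, bump functions and compact balls in model spaces\<close>

lemma finite_dimensional_real: "finite_dimensional_type TYPE(real)"
proof -
  have "x \<in> span {1}" for x :: real
    using span_scale[of "1::real" "{1}" x] by (simp add: span_base)
  then show ?thesis
    unfolding finite_dimensional_type_def by (intro exI[of _ "{1}"]) auto
qed

text \<open>The functions \<open>t\<^sup>-\<^sup>n exp (- 1 / t)\<close>, extended by 0; their span is closed under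
  differentiation.\<close>

definition flat :: "nat \<Rightarrow> real \<Rightarrow> real"
  where "flat n t = (if t \<le> 0 then 0 else inverse t ^ n * exp (- inverse t))"

text \<open>Away from 0 this is a computation; at 0 the exponential decay beats every power, so the
  derivative is 0, as is the right-hand side there.\<close>

lemma flat_has_derivative:
  "(flat n has_real_derivative flat (n + 2) t - real n * flat (n + 1) t) (at t)"
proof -
  consider "t < 0" | "t > 0" | "t = 0" by linarith
  then show ?thesis
  proof cases
    case 1
    have "((\<lambda>_. 0) has_real_derivative 0) (at t)" by simp
    then have "(flat n has_real_derivative 0) (at t)"
      by (rule has_field_derivative_transform_within_open[where S = "{..<0}"]) (use 1 in \<open>auto simp: flat_def\<close>)
    then show ?thesis using 1 by (simp add: flat_def)
  next
    case 2
    have "((\<lambda>t. inverse t ^ n * exp (- inverse t)) has_real_derivative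
      flat (n + 2) t - real n * flat (n + 1) t) (at t)"
    proof (rule derivative_eq_intros)
      show "((\<lambda>t. inverse t ^ n) has_real_derivative real n * inverse t ^ (n - 1) * - (inverse t)\<^sup>2) (at t)"
        using 2 by (auto intro!: derivative_eq_intros simp: power2_eq_square)
      show "((\<lambda>t. exp (- inverse t)) has_real_derivative exp (- inverse t) * (inverse t)\<^sup>2) (at t)"
        using 2 by (auto intro!: derivative_eq_intros simp: power2_eq_square)
      show "real n * inverse t ^ (n - 1) * - (inverse t)\<^sup>2 * exp (- inverse t) +
          exp (- inverse t) * (inverse t)\<^sup>2 * inverse t ^ n = flat (n + 2) t - real n * flat (n + 1) t"
        using 2 by (cases n) (simp_all add: flat_def power2_eq_square algebra_simps)
    qed
    then show ?thesis
      by (rule has_field_derivative_transform_within_open[where S = "{0<..}"]) (use 2 in \<open>auto simp: flat_def\<close>)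
  next
    case 3
    \<comment> \<open>The substitution s = 1/t turns the right difference quotient at 0 into this
      function of s.\<close>
    have "((\<lambda>s::real. s ^ (n + 1) / exp s) \<longlongrightarrow> 0) at_top" for n
      by (rule tendsto_power_div_exp_0)
    then have "((\<lambda>t. inverse t ^ (n + 1) / exp (inverse t)) \<longlongrightarrow> 0) (at_right (0::real))"
      by (subst (asm) filterlim_at_top_to_right)
    moreover have "eventually (\<lambda>t. inverse t ^ (n + 1) / exp (inverse t) = flat n t / t) (at_right (0::real))"
      unfolding eventually_at_filter
      by (auto simp: flat_def exp_minus field_simps intro!: always_eventually)
    ultimately have "((\<lambda>t. flat n t / t) \<longlongrightarrow> 0) (at_right (0::real))"
      using tendsto_cong by force
    moreover have "((\<lambda>t. flat n t / t) \<longlongrightarrow> 0) (at_left (0::real))"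
      by (rule tendsto_eventually) (auto simp: flat_def eventually_at_filter)
    ultimately have "((\<lambda>t. flat n t / t) \<longlongrightarrow> 0) (at 0)"
      by (simp add: filterlim_split_at)
    then show ?thesis using 3 by (simp add: has_field_derivative_iff flat_def)
  qed
qed

text \<open>All \<open>n\<close> are treated together, since the derivative of \<open>flat n\<close>
  involves \<open>flat (n + 1)\<close> and \<open>flat (n + 2)\<close>.\<close>

lemma Cinf_on_flat: "Cinf_on UNIV (flat n)"
proof -
  have "Ck_on k UNIV (flat n)" for k
  proof (induction k arbitrary: n)
    case 0
    show ?case using flat_has_derivative
      by (auto intro!: continuous_at_imp_continuous_on intro: DERIV_isCont)
  next
    case (Suc k)
    show ?case
    proof (rule Ck_on_SucI)
      show "(flat n has_derivative (*) (flat (n + 2) x - real n * flat (n + 1) x)) (at x)" for x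
        using flat_has_derivative by (simp add: has_field_derivative_def)
      have "Ck_on k UNIV (\<lambda>x. v * flat (n + 2) x + (- v * real n) * flat (n + 1) x)" for v
        by (intro Ck_on_add Ck_on_bilinear[OF bounded_bilinear_mult] Ck_on_const Suc open_UNIV)
      then show "Ck_on k UNIV (\<lambda>x. (flat (n + 2) x - real n * flat (n + 1) x) * v)" for v
        by (simp add: algebra_simps)
    qed auto
  qed
  then show ?thesis by (simp add: Cinf_on_def)
qed

text \<open>The classical quotient a / (a + b) with a = \<open>flat 0 (2 - t)\<close> and b =
  \<open>flat 0 (t - 1)\<close>: b vanishes for t \<le> 1, a vanishes for t \<ge> 2, and never both.
  Differences are written as sums so that the closure rules apply.\<close>

lemma Cinf_bump_real:
  obtains h :: "real \<Rightarrow> real" where "Cinf_on UNIV h" "\<And>t. t \<le> 1 \<Longrightarrow> h t = 1" "\<And>t. t \<ge> 2 \<Longrightarrow> h t = 0"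
proof
  let ?d = "\<lambda>t. flat 0 (2 + - 1 * t) + flat 0 (t + - 1)"
  have pos: "?d t > 0" for t
    by (simp add: flat_def add_pos_pos)
  have "Cinf_on UNIV (\<lambda>t::real. 2 + - 1 * t)"
    by (rule Cinf_on_add[OF open_UNIV Cinf_on_const
          Cinf_on_bounded_linear[OF bounded_linear_mult_right open_UNIV Cinf_on_id[OF open_UNIV]]])
  moreover have "Cinf_on UNIV (\<lambda>t::real. t + - 1)"
    by (rule Cinf_on_add[OF open_UNIV Cinf_on_id[OF open_UNIV] Cinf_on_const])
  ultimately have lin: "Cinf_on UNIV (\<lambda>t::real. 2 + - 1 * t)" "Cinf_on UNIV (\<lambda>t::real. t + - 1)" .
  note comp = Cinf_on_compose[OF finite_dimensional_real open_UNIV subset_UNIV Cinf_on_flat]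
  have d: "Cinf_on UNIV ?d"
    by (intro Cinf_on_add comp lin open_UNIV)
  have "Cinf_on {0<..} (inverse :: real \<Rightarrow> real)"
    by (auto simp: Cinf_on_def intro!: Ck_on_inverse)
  then have "Cinf_on UNIV (\<lambda>t. inverse (?d t))"
    using Cinf_on_compose[OF finite_dimensional_real open_UNIV _ _ d, of "{0<..}" inverse] pos by auto
  then show "Cinf_on UNIV (\<lambda>t. flat 0 (2 + - 1 * t) * inverse (?d t))"
    by (intro Cinf_on_bilinear[OF bounded_bilinear_mult] comp lin open_UNIV)
  show "flat 0 (2 + - 1 * t) * inverse (?d t) = 1" if "t \<le> 1" for t
    using that pos[of t] by (simp add: flat_def)
  show "flat 0 (2 + - 1 * t) * inverse (?d t) = 0" if "t \<ge> 2" for t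
    using that by (simp add: flat_def)
qed

text \<open>The squared distance is used because, unlike the distance, it is smooth at the centre.
  The factor \<open>2 / r\<^sup>2\<close> makes the argument of \<open>h\<close> equal to 2 at
  distance r, where \<open>h\<close> has become 0; at distance r/2 the argument is 1/2, safely in
  the region where \<open>h\<close> is 1.\<close>

lemma Cinf_bump:
  fixes x0 :: "'a::real_inner"
  assumes "r > 0"
  obtains \<eta> :: "'a \<Rightarrow> real" and s where "Cinf_on UNIV \<eta>" "s > 0" "\<And>x. dist x0 x < s \<Longrightarrow> \<eta> x = 1"
    "\<And>x. dist x0 x \<ge> r \<Longrightarrow> \<eta> x = 0"
proof -
  obtain h :: "real \<Rightarrow> real" where h: "Cinf_on UNIV h" "\<And>t. t \<le> 1 \<Longrightarrow> h t = 1" "\<And>t. t \<ge> 2 \<Longrightarrow> h t = 0"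
    using Cinf_bump_real by blast
  let ?q = "\<lambda>x. 2 / r\<^sup>2 * ((x + - x0) \<bullet> (x + - x0))"
  have q: "?q x = 2 * (dist x0 x / r)\<^sup>2" for x
  proof -
    have "(x + - x0) \<bullet> (x + - x0) = (dist x0 x)\<^sup>2"
      by (simp add: dist_norm norm_minus_commute dot_square_norm)
    then show ?thesis by (simp only:) (simp add: power_divide)
  qed
  have "Cinf_on UNIV ?q"
    by (intro Cinf_on_bilinear[OF bounded_bilinear_mult] Cinf_on_bilinear[OF bounded_bilinear_inner]
      Cinf_on_add Cinf_on_const Cinf_on_id open_UNIV)
  then have "Cinf_on UNIV (\<lambda>x. h (?q x))"
    by (intro Cinf_on_compose[OF finite_dimensional_real open_UNIV subset_UNIV h(1)])
  moreover have "h (?q x) = 1" if "dist x0 x < r / 2" for x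
  proof -
    have "dist x0 x / r \<le> 1 / 2" using that assms by (simp add: field_simps)
    then have "(dist x0 x / r)\<^sup>2 \<le> (1 / 2)\<^sup>2" using assms by (intro power_mono) auto
    moreover have "(1 / 2 :: real)\<^sup>2 = 1 / 4" by (simp add: power2_eq_square)
    ultimately have "2 * (dist x0 x / r)\<^sup>2 \<le> 1" by linarith
    then show ?thesis by (intro h(2)) (simp only: q)
  qed
  moreover have "h (?q x) = 0" if "dist x0 x \<ge> r" for x
  proof -
    have "1 \<le> dist x0 x / r" using that assms by (simp add: field_simps)
    then have "1 \<le> (dist x0 x / r)\<^sup>2" by (rule one_le_power)
    then show ?thesis by (intro h(3)) (use q[of x] in linarith)
  qed
  ultimately show thesis using that[of "\<lambda>x. h (?q x)" "r / 2"] assms by auto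
qed

text \<open>A coordinate box is compact, being built one basis vector at a time as a continuous
  image of an interval times a smaller box. By Cauchy-Schwarz the ball about 0 is a closed subset of
  such a box; a translation moves the centre.\<close>

lemma compact_cball_finite_dimensional:
  assumes "finite_dimensional_type TYPE('a::real_inner)"
  shows "compact (cball (x0::'a::real_inner) r)"
proof -
  obtain B :: "'a set" where "orthonormal_basis B"
    using finite_dimensional_orthonormal_basis[OF assms] .
  then have B: "finite B" "\<And>b. b \<in> B \<Longrightarrow> b \<bullet> b = 1" "\<And>x. (\<Sum>b\<in>B. (x \<bullet> b) *\<^sub>R b) = x"
    by (auto simp: orthonormal_basis_def)
  define box where "box C = {\<Sum>b\<in>C. c b *\<^sub>R b | c. \<forall>b\<in>C. \<bar>c b\<bar> \<le> r}" for C :: "'a set"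
  have "compact (box C)" if "finite C" for C
    using that
  proof (induction C)
    case (insert b C)
    have "box (insert b C) = (\<lambda>(t, x). t *\<^sub>R b + x) ` ({-r..r} \<times> box C)"
    proof (intro equalityI subsetI)
      fix x assume "x \<in> box (insert b C)"
      then obtain c where "x = c b *\<^sub>R b + (\<Sum>b\<in>C. c b *\<^sub>R b)" "\<bar>c b\<bar> \<le> r" "\<forall>b\<in>C. \<bar>c b\<bar> \<le> r"
        using insert by (auto simp: box_def)
      then show "x \<in> (\<lambda>(t, x). t *\<^sub>R b + x) ` ({-r..r} \<times> box C)"
        by (intro image_eqI[of _ _ "(c b, \<Sum>b\<in>C. c b *\<^sub>R b)"]) (auto simp: box_def)
    next
      fix x assume "x \<in> (\<lambda>(t, x). t *\<^sub>R b + x) ` ({-r..r} \<times> box C)"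
      then obtain t c where x: "x = t *\<^sub>R b + (\<Sum>b\<in>C. c b *\<^sub>R b)" "\<bar>t\<bar> \<le> r" "\<forall>b\<in>C. \<bar>c b\<bar> \<le> r"
        by (auto simp: box_def)
      then have "x = (\<Sum>a\<in>insert b C. (c(b := t)) a *\<^sub>R a)"
        using insert by (auto intro!: sum.cong)
      then show "x \<in> box (insert b C)"
        using x insert by (auto simp: box_def intro!: exI[of _ "c(b := t)"])
    qed
    moreover have "continuous_on ({-r..r} \<times> box C) (\<lambda>(t, x). t *\<^sub>R b + x)"
      unfolding case_prod_beta by (intro continuous_intros)
    ultimately show ?case
      using insert by (auto intro: compact_continuous_image compact_Times)
  qed (simp add: box_def)
  moreover have "cball 0 r \<subseteq> box B"
  proof
    fix x assume x: "x \<in> cball (0::'a) r"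
    have "\<bar>x \<bullet> b\<bar> \<le> r" if "b \<in> B" for b
      using Cauchy_Schwarz_ineq2[of x b] x B(2)[OF that] by (simp add: norm_eq_sqrt_inner)
    then show "x \<in> box B" unfolding box_def using B(3)[of x, symmetric] by blast
  qed
  ultimately have "compact (cball (0::'a) r)"
    using B(1) compact_Int_closed[of "box B" "cball 0 r"] by (simp add: Int_absorb1)
  then have "compact ((+) x0 ` cball 0 r)" by (intro compact_continuous_image continuous_intros)
  then show ?thesis by simp
qed

section \<open>Smooth functions and tangent vectors on a manifold\<close>

locale smooth_mfd =
  fixes A :: "('m::{t2_space,second_countable_topology}, 'a::real_inner) atlas"
  assumes mfd: "smooth_manifold A"
begin

lemma finite_dimensional_model: "finite_dimensional_type TYPE('a)"
  using mfd unfolding smooth_manifold_def by (elim conjE)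

lemma chart_at: obtains V \<phi> where "(V, \<phi>) \<in> A" "p \<in> V"
proof -
  have "(\<Union>(V, \<phi>)\<in>A. V) = UNIV" using mfd unfolding smooth_manifold_def by (elim conjE)
  then have "p \<in> (\<Union>(V, \<phi>)\<in>A. V)" by simp
  then show thesis using that by auto
qed

lemma chartD:
  assumes "(V, \<phi>) \<in> A"
  shows "open V" "open (\<phi> ` V)" "homeomorphism V (\<phi> ` V) \<phi> (inv_into V \<phi>)" "inj_on \<phi> V"
proof -
  have "\<forall>(V, \<phi>)\<in>A. open V \<and> open (\<phi> ` V) \<and> homeomorphism V (\<phi> ` V) \<phi> (inv_into V \<phi>)"
    using mfd unfolding smooth_manifold_def by (elim conjE)
  from bspec[OF this assms] show "open V" "open (\<phi> ` V)"
    and h: "homeomorphism V (\<phi> ` V) \<phi> (inv_into V \<phi>)"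
    by simp_all
  show "inj_on \<phi> V" by (rule inj_on_inverseI) (rule homeomorphism_apply1[OF h])
qed

lemma chart_transition:
  assumes "(V, \<phi>) \<in> A" "(V', \<phi>') \<in> A"
  shows "Cinf_on (\<phi> ` (V \<inter> V')) (\<phi>' \<circ> inv_into V \<phi>)"
proof -
  have "\<forall>(V, \<phi>)\<in>A. \<forall>(V', \<phi>')\<in>A. Cinf_on (\<phi> ` (V \<inter> V')) (\<phi>' \<circ> inv_into V \<phi>)"
    using mfd unfolding smooth_manifold_def by (elim conjE)
  from bspec[OF this assms(1)] show ?thesis using assms(2) by fast
qed

lemma open_chart_image:
  assumes "(V, \<phi>) \<in> A" "open W"
  shows "open (\<phi> ` (W \<inter> V))"
proof -
  have "openin (top_of_set V) (W \<inter> V)" using assms(2) by (auto simp: openin_open)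
  then have "openin (top_of_set (\<phi> ` V)) (\<phi> ` (W \<inter> V))"
    using homeomorphism_imp_open_map[OF chartD(3)[OF assms(1)]] by blast
  then show ?thesis using chartD(2)[OF assms(1)] by (simp add: openin_open_eq)
qed

lemma smooth_map_on_chart:
  "smooth_map_on A U f \<Longrightarrow> (V, \<phi>) \<in> A \<Longrightarrow> Cinf_on (\<phi> ` (U \<inter> V)) (\<lambda>x. f (inv_into V \<phi> x))"
  by (auto simp: smooth_map_on_def o_def)

lemma smooth_map_onI:
  "(\<And>V \<phi>. (V, \<phi>) \<in> A \<Longrightarrow> Cinf_on (\<phi> ` (U \<inter> V)) (\<lambda>x. f (inv_into V \<phi> x))) \<Longrightarrow> smooth_map_on A U f"
  by (auto simp: smooth_map_on_def o_def)

lemma smooth_map_on_subset: "smooth_map_on A U f \<Longrightarrow> W \<subseteq> U \<Longrightarrow> smooth_map_on A W f"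
  by (rule smooth_map_onI, rule Cinf_on_subset[OF smooth_map_on_chart]) auto

lemma smooth_map_on_cong:
  assumes "open U" "\<And>p. p \<in> U \<Longrightarrow> f p = g p" "smooth_map_on A U f"
  shows "smooth_map_on A U g"
proof (rule smooth_map_onI)
  fix V \<phi> assume V: "(V, \<phi>) \<in> A"
  have "f (inv_into V \<phi> x) = g (inv_into V \<phi> x)" if "x \<in> \<phi> ` (U \<inter> V)" for x
    using that chartD(4)[OF V] assms(2) by auto
  then show "Cinf_on (\<phi> ` (U \<inter> V)) (\<lambda>x. g (inv_into V \<phi> x))"
    by (rule iffD1[OF Cinf_on_cong[OF open_chart_image[OF V assms(1)]] smooth_map_on_chart[OF assms(3) V]])
qed

lemma smooth_map_on_local:
  assumes "\<And>p. p \<in> U \<Longrightarrow> \<exists>W. open W \<and> p \<in> W \<and> smooth_map_on A W f"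
  shows "smooth_map_on A U f"
proof (rule smooth_map_onI, rule Cinf_on_local)
  fix V \<phi> x assume V: "(V, \<phi>) \<in> A" and "x \<in> \<phi> ` (U \<inter> V)"
  then obtain p where p: "p \<in> U" "p \<in> V" "x = \<phi> p" by auto
  then obtain W where "open W" "p \<in> W" "smooth_map_on A W f" using assms by blast
  then show "\<exists>T. open T \<and> x \<in> T \<and> Cinf_on T (\<lambda>x. f (inv_into V \<phi> x))"
    using p by (intro exI[of _ "\<phi> ` (W \<inter> V)"])
      (auto intro: open_chart_image[OF V] smooth_map_on_chart[OF _ V])
qed

lemma smooth_map_on_const: "smooth_map_on A U (\<lambda>p. c)"
  by (intro smooth_map_onI Cinf_on_const)

lemma smooth_map_on_add:
  "open U \<Longrightarrow> smooth_map_on A U f \<Longrightarrow> smooth_map_on A U g \<Longrightarrow> smooth_map_on A U (\<lambda>p. f p + g p)"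
  by (rule smooth_map_onI) (simp add: Cinf_on_add smooth_map_on_chart open_chart_image)

lemma smooth_map_on_sum:
  "open U \<Longrightarrow> (\<And>i. i \<in> I \<Longrightarrow> smooth_map_on A U (f i)) \<Longrightarrow> smooth_map_on A U (\<lambda>p. \<Sum>i\<in>I. f i p)"
  by (rule smooth_map_onI) (simp add: Cinf_on_sum smooth_map_on_chart open_chart_image)

lemma smooth_map_on_bilinear:
  assumes "bounded_bilinear pr" "open U" "smooth_map_on A U f" "smooth_map_on A U g"
  shows "smooth_map_on A U (\<lambda>p. pr (f p) (g p))"
proof (rule smooth_map_onI)
  fix V \<phi> assume V: "(V, \<phi>) \<in> A"
  show "Cinf_on (\<phi> ` (U \<inter> V)) (\<lambda>x. pr (f (inv_into V \<phi> x)) (g (inv_into V \<phi> x)))"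
    by (rule Cinf_on_bilinear[OF assms(1) open_chart_image[OF V assms(2)]
          smooth_map_on_chart[OF assms(3) V] smooth_map_on_chart[OF assms(4) V]])
qed

lemmas smooth_map_on_mult = smooth_map_on_bilinear[OF bounded_bilinear_mult]
lemmas smooth_map_on_scaleR = smooth_map_on_bilinear[OF bounded_bilinear_scaleR]
lemmas smooth_map_on_inner = smooth_map_on_bilinear[OF bounded_bilinear_inner]

text \<open>Read in another chart, the function is \<open>h\<close> after a transition map. This
  supplies coordinate functions and cutoffs on a chart domain.\<close>

lemma smooth_map_on_chart_compose:
  assumes V: "(V, \<phi>) \<in> A" and h: "Cinf_on UNIV h"
  shows "smooth_map_on A V (\<lambda>p. h (\<phi> p))"
proof (rule smooth_map_onI)
  fix V' \<phi>' assume V': "(V', \<phi>') \<in> A"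
  have "Cinf_on (\<phi>' ` (V' \<inter> V)) (\<phi> \<circ> inv_into V' \<phi>')"
    by (rule chart_transition[OF V' V])
  then show "Cinf_on (\<phi>' ` (V \<inter> V')) (\<lambda>x. h (\<phi> (inv_into V' \<phi>' x)))"
    by (intro Cinf_on_compose[OF finite_dimensional_model open_chart_image[OF V'] _ h] chartD(1)[OF V])
      (auto simp: o_def Int_commute)
qed

lemma smooth_functionsD: "f \<in> smooth_functions A \<Longrightarrow> open U \<Longrightarrow> smooth_map_on A U f"
  by (auto simp: smooth_functions_def intro: smooth_map_on_subset)

lemma smooth_functions_const: "(\<lambda>p. c) \<in> smooth_functions A"
  by (simp add: smooth_functions_def smooth_map_on_const)

lemma smooth_functions_mult: "f \<in> smooth_functions A \<Longrightarrow> g \<in> smooth_functions A \<Longrightarrow> f * g \<in> smooth_functions A"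
  by (simp add: smooth_functions_def smooth_map_on_mult times_fun_def)

text \<open>Extension by zero: near a point of \<open>U\<close> the map is a product of smooth ones,
  and off \<open>U\<close> the open set \<open>W - C\<close> is a neighbourhood on which it
  vanishes. The second case is where closedness of \<open>C\<close> matters. The vanishing is
  demanded of \<open>g\<close>, not of \<open>\<eta>\<close>, so \<open>\<eta>\<close> may also be
  constant.\<close>

lemma smooth_map_on_extend:
  assumes "open U" "open W" "closed C" "C \<subseteq> U" "smooth_map_on A (U \<inter> W) f" "\<eta> \<in> smooth_functions A"
    and "\<And>p. p \<in> U \<inter> W \<Longrightarrow> g p = \<eta> p *\<^sub>R f p" "\<And>p. p \<in> W - C \<Longrightarrow> g p = 0"
  shows "smooth_map_on A W g"
proof (rule smooth_map_on_local)
  fix p assume "p \<in> W"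
  show "\<exists>T. open T \<and> p \<in> T \<and> smooth_map_on A T g"
  proof (cases "p \<in> U")
    case True
    have o: "open (U \<inter> W)" using assms(1,2) by blast
    have "smooth_map_on A (U \<inter> W) (\<lambda>p. \<eta> p *\<^sub>R f p)"
      by (rule smooth_map_on_scaleR[OF o smooth_functionsD[OF assms(6) o] assms(5)])
    then have "smooth_map_on A (U \<inter> W) g"
      by (rule smooth_map_on_cong[OF o, rotated]) (simp add: assms(7))
    then show ?thesis using True \<open>p \<in> W\<close> assms by blast
  next
    case False
    have "smooth_map_on A (W - C) g"
      by (rule smooth_map_on_cong[OF _ _ smooth_map_on_const[of _ 0]]) (use assms in auto)
    then show ?thesis using False \<open>p \<in> W\<close> assms by blast
  qed
qed

text \<open>Two sets are returned: \<open>W\<close>, where multiplying by \<open>\<eta>\<close>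
  changes nothing, and the closed \<open>C\<close>, outside which everything multiplied by
  \<open>\<eta>\<close> dies.\<close>

lemma bump_function:
  assumes "open U" "p \<in> U"
  obtains \<eta> W C where "\<eta> \<in> smooth_functions A" "open W" "p \<in> W" "W \<subseteq> U" "closed C" "C \<subseteq> U"
    "\<And>q. q \<in> W \<Longrightarrow> \<eta> q = 1" "\<And>q. q \<notin> C \<Longrightarrow> \<eta> q = 0"
proof -
  obtain V \<phi> where V: "(V, \<phi>) \<in> A" "p \<in> V" using chart_at .
  note V' = chartD[OF V(1)]
  obtain r where r: "r > 0" "cball (\<phi> p) r \<subseteq> \<phi> ` (U \<inter> V)"
    using open_contains_cball open_chart_image[OF V(1) assms(1)] assms(2) V(2) by blast
  obtain h s where h: "Cinf_on UNIV h" "s > 0" "\<And>x. dist (\<phi> p) x < s \<Longrightarrow> h x = 1"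
    "\<And>x. dist (\<phi> p) x \<ge> r \<Longrightarrow> h x = (0::real)"
    using Cinf_bump[OF r(1)] by blast
  define C where "C = inv_into V \<phi> ` cball (\<phi> p) r"
  define W where "W = (V \<inter> \<phi> -` ball (\<phi> p) s) \<inter> U"
  define \<eta> where "\<eta> q = (if q \<in> V then h (\<phi> q) else 0)" for q
  have "continuous_on (cball (\<phi> p) r) (inv_into V \<phi>)"
    using V'(3) r(2) by (auto simp: homeomorphism_def intro: continuous_on_subset)
  \<comment> \<open>A set closed in the chart domain need not be closed in the manifold; compactness
    and the Hausdorff property give that.\<close>
  then have "compact C"
    unfolding C_def by (intro compact_continuous_image compact_cball_finite_dimensional finite_dimensional_model)
  then have C: "closed C" by (rule compact_imp_closed)
  have CU: "C \<subseteq> U \<inter> V"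
  proof
    fix q assume "q \<in> C"
    then obtain x where x: "x \<in> cball (\<phi> p) r" "q = inv_into V \<phi> x" by (auto simp: C_def)
    then obtain q' where "q' \<in> U \<inter> V" "x = \<phi> q'" using r(2) by blast
    then show "q \<in> U \<inter> V" using x(2) V'(4) by simp
  qed
  have z: "\<eta> q = 0" if "q \<notin> C" for q
  proof (cases "q \<in> V")
    case True
    then have "\<phi> q \<notin> cball (\<phi> p) r" using that inv_into_f_f[OF V'(4)] by (metis C_def image_eqI)
    then show ?thesis by (simp add: \<eta>_def h(4))
  qed (simp add: \<eta>_def)
  have "smooth_map_on A V (\<lambda>q. h (\<phi> q))" by (rule smooth_map_on_chart_compose[OF V(1) h(1)])
  \<comment> \<open>The cutoff is already contained in \<open>h\<close>, so the factor of the
    extension lemma is taken to be 1.\<close>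
  then have "smooth_map_on A UNIV \<eta>"
    using V'(1) C CU z
    by (rule_tac smooth_map_on_extend[where U = V and C = C and f = "\<lambda>q. h (\<phi> q)" and \<eta> = "\<lambda>_. 1"])
      (auto simp: smooth_functions_const \<eta>_def)
  moreover have "open W"
    unfolding W_def using V' assms(1)
    by (intro open_Int continuous_open_preimage) (auto simp: homeomorphism_def)
  moreover have "p \<in> W" "W \<subseteq> U" using assms V(2) h(2) by (auto simp: W_def)
  moreover have "\<eta> q = 1" if "q \<in> W" for q using that h(3) by (auto simp: W_def \<eta>_def)
  ultimately show thesis using that[of \<eta> W C] C CU z by (auto simp: smooth_functions_def)
qed

section \<open>Tangent vectors as derivations, and their coordinates\<close>

lemma chart_vector_mult:
  assumes V: "(V, \<phi>) \<in> A" "p \<in> V" and f: "f \<in> smooth_functions A" "g \<in> smooth_functions A"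
  shows "chart_vector A V \<phi> p w (f * g) = f p * chart_vector A V \<phi> p w g + g p * chart_vector A V \<phi> p w f"
proof -
  have *: "((h \<circ> inv_into V \<phi>) has_derivative frechet_derivative (h \<circ> inv_into V \<phi>) (at (\<phi> p))) (at (\<phi> p))"
    if "h \<in> smooth_functions A" for h
    using smooth_map_on_chart[of UNIV h V \<phi>] V that
    by (intro Cinf_on_has_derivative[of "\<phi> ` V"]) (auto simp: smooth_functions_def o_def)
  have "((\<lambda>x. (f \<circ> inv_into V \<phi>) x * (g \<circ> inv_into V \<phi>) x) has_derivative
    (\<lambda>w. f p * frechet_derivative (g \<circ> inv_into V \<phi>) (at (\<phi> p)) w +
      frechet_derivative (f \<circ> inv_into V \<phi>) (at (\<phi> p)) w * g p)) (at (\<phi> p))"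
    using has_derivative_mult[OF *[OF f(1)] *[OF f(2)]] chartD(4)[OF V(1)] V(2) by simp
  then have "frechet_derivative (f * g \<circ> inv_into V \<phi>) (at (\<phi> p)) =
    (\<lambda>w. f p * frechet_derivative (g \<circ> inv_into V \<phi>) (at (\<phi> p)) w +
      frechet_derivative (f \<circ> inv_into V \<phi>) (at (\<phi> p)) w * g p)"
    by (intro frechet_derivative_at[symmetric]) (simp add: o_def times_fun_def)
  then show ?thesis using f by (simp add: chart_vector_def smooth_functions_mult)
qed

text \<open>Chain rule: \<open>w'\<close> is the image of \<open>w\<close> under the derivative of
  the transition map at \<open>\<phi> p\<close>. On functions that are not smooth both operators are
  0 by convention.\<close>

lemma chart_vector_change:
  assumes V: "(V, \<phi>) \<in> A" "p \<in> V" and V': "(V', \<phi>') \<in> A" "p \<in> V'"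
  obtains w' where "chart_vector A V \<phi> p w = chart_vector A V' \<phi>' p w'"
proof -
  let ?t = "\<phi>' \<circ> inv_into V \<phi>"
  have "Cinf_on (\<phi> ` (V \<inter> V')) ?t" by (rule chart_transition[OF V(1) V'(1)])
  then have t: "(?t has_derivative frechet_derivative ?t (at (\<phi> p))) (at (\<phi> p))"
    using V V' by (intro Cinf_on_has_derivative) auto
  have inv: "inv_into V \<phi> (\<phi> q) = q" if "q \<in> V" for q using chartD(4)[OF V(1)] that by simp
  have inv': "inv_into V' \<phi>' (\<phi>' q) = q" if "q \<in> V'" for q using chartD(4)[OF V'(1)] that by simp
  have "frechet_derivative (f \<circ> inv_into V \<phi>) (at (\<phi> p)) w =
    frechet_derivative (f \<circ> inv_into V' \<phi>') (at (\<phi>' p)) (frechet_derivative ?t (at (\<phi> p)) w)"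
    if f: "f \<in> smooth_functions A" for f
  proof -
    let ?g = "f \<circ> inv_into V' \<phi>'"
    have "(?g has_derivative frechet_derivative ?g (at (\<phi>' p))) (at (\<phi>' p))"
      using smooth_map_on_chart[of UNIV f V' \<phi>'] V' f
      by (intro Cinf_on_has_derivative[of "\<phi>' ` V'"]) (auto simp: smooth_functions_def o_def)
    moreover have "?t (\<phi> p) = \<phi>' p" using inv V by simp
    ultimately have "(?g has_derivative frechet_derivative ?g (at (\<phi>' p))) (at (?t (\<phi> p)))"
      by (simp only:)
    from has_derivative_compose[OF t this] have "((\<lambda>x. ?g (?t x)) has_derivative
      (\<lambda>w. frechet_derivative ?g (at (\<phi>' p)) (frechet_derivative ?t (at (\<phi> p)) w))) (at (\<phi> p))" .
    then have "((f \<circ> inv_into V \<phi>) has_derivative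
      (\<lambda>w. frechet_derivative ?g (at (\<phi>' p)) (frechet_derivative ?t (at (\<phi> p)) w))) (at (\<phi> p))"
      by (rule has_derivative_transform_within_open[where s = "\<phi> ` (V' \<inter> V)"])
        (use V V' inv inv' open_chart_image[OF V(1) chartD(1)[OF V'(1)]] in auto)
    then show ?thesis using frechet_derivative_at by metis
  qed
  then have "chart_vector A V \<phi> p w = chart_vector A V' \<phi>' p (frechet_derivative ?t (at (\<phi> p)) w)"
    by (auto simp: chart_vector_def)
  then show thesis using that by blast
qed

text \<open>Test on the function \<open>(w - w') \<bullet> \<phi> q\<close>, whose derivatives along
  \<open>w\<close> and \<open>w'\<close> differ by the squared norm of \<open>w - w'\<close>. It
  lives on the chart only, so a bump function makes it an admissible global test function.\<close>

lemma chart_vector_inj: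
  assumes V: "(V, \<phi>) \<in> A" "p \<in> V" and eq: "chart_vector A V \<phi> p w = chart_vector A V \<phi> p w'"
  shows "w = w'"
proof -
  obtain \<eta> W C where b: "\<eta> \<in> smooth_functions A" "open W" "p \<in> W" "W \<subseteq> V" "closed C" "C \<subseteq> V"
    "\<And>q. q \<in> W \<Longrightarrow> \<eta> q = 1" "\<And>q. q \<notin> C \<Longrightarrow> \<eta> q = 0"
    using bump_function[OF chartD(1)[OF V(1)] V(2)] by blast
  define f where "f q = \<eta> q *\<^sub>R ((w - w') \<bullet> \<phi> q)" for q
  have "smooth_map_on A V (\<lambda>q. (w - w') \<bullet> \<phi> q)"
    by (rule smooth_map_on_inner[OF chartD(1)[OF V(1)] smooth_map_on_const
          smooth_map_on_chart_compose[OF V(1) Cinf_on_id[OF open_UNIV]]])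
  then have "smooth_map_on A UNIV f"
    using b chartD(1)[OF V(1)]
    by (rule_tac smooth_map_on_extend[where U = V and C = C
          and f = "\<lambda>q. (w - w') \<bullet> \<phi> q" and \<eta> = \<eta>])
      (auto simp: f_def)
  then have f: "f \<in> smooth_functions A" by (simp add: smooth_functions_def)
  have "((\<lambda>x. (w - w') \<bullet> x) has_derivative (\<lambda>x. (w - w') \<bullet> x)) (at (\<phi> p))"
    by (intro bounded_linear_imp_has_derivative bounded_linear_inner_right)
  then have "((f \<circ> inv_into V \<phi>) has_derivative (\<lambda>x. (w - w') \<bullet> x)) (at (\<phi> p))"
    by (rule has_derivative_transform_within_open[where s = "\<phi> ` (W \<inter> V)"])
      (use V b chartD(4)[OF V(1)] open_chart_image[OF V(1) b(2)] in \<open>auto simp: f_def\<close>)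
  then have "frechet_derivative (f \<circ> inv_into V \<phi>) (at (\<phi> p)) = (\<lambda>x. (w - w') \<bullet> x)"
    using frechet_derivative_at by metis
  then have "(w - w') \<bullet> w = (w - w') \<bullet> w'"
    using fun_cong[OF eq, of f] f by (simp add: chart_vector_def)
  then have "(w - w') \<bullet> (w - w') = 0" by (simp add: inner_diff_right)
  then show ?thesis by simp
qed

text \<open>The fibre allows any chart around the point, the trivialization fixes one: a change of
  chart gives existence and injectivity gives uniqueness, so the definite description denotes the
  coordinates.\<close>

lemma tangent_vector_chart:
  assumes X: "X \<in> fibre (tangent_bundle A) p" and V: "(V, \<phi>) \<in> A" "p \<in> V"
  shows "chart_vector A V \<phi> p (THE w. X = chart_vector A V \<phi> p w) = X"
proof -
  obtain w where "X = chart_vector A V \<phi> p w"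
    using X chart_vector_change V by (auto simp: tangent_bundle_def) metis
  then have "X = chart_vector A V \<phi> p (THE w. X = chart_vector A V \<phi> p w)"
    by (rule theI) (use chart_vector_inj[OF V] \<open>X = _\<close> in blast)
  then show ?thesis by simp
qed

lemma tangent_vector_mult:
  assumes "X \<in> fibre (tangent_bundle A) p" "f \<in> smooth_functions A" "g \<in> smooth_functions A"
  shows "X (f * g) = f p * X g + g p * X f"
  using assms chart_vector_mult by (auto simp: tangent_bundle_def)

lemma tangent_vector_nonsmooth:
  assumes "X \<in> fibre (tangent_bundle A) p" "f \<notin> smooth_functions A"
  shows "X f = 0"
  using assms by (auto simp: tangent_bundle_def chart_vector_def)

text \<open>In a chart, X(f) is the sum of the components of X times the partial derivatives of f.
  The hypotheses concern \<open>U\<close> only, because the result is needed for fields defined over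
  a single trivialization.\<close>

lemma smooth_derivative:
  assumes U: "open U" and X: "\<And>p. p \<in> U \<Longrightarrow> X p \<in> fibre (tangent_bundle A) p"
    and sm: "\<And>V \<Phi>. (V, \<Phi>) \<in> trivs (tangent_bundle A) \<Longrightarrow> smooth_map_on A (U \<inter> V) (\<lambda>p. \<Phi> p (X p))"
    and f: "f \<in> smooth_functions A"
  shows "smooth_map_on A U (\<lambda>p. X p f)"
proof (rule smooth_map_onI)
  fix V \<phi> assume V: "(V, \<phi>) \<in> A"
  obtain B :: "'a set" where B: "orthonormal_basis B"
    using finite_dimensional_orthonormal_basis[OF finite_dimensional_model] .
  let ?w = "\<lambda>p. THE w. X p = chart_vector A V \<phi> p w" and ?f = "f \<circ> inv_into V \<phi>"
  let ?S = "\<phi> ` (U \<inter> V)"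
  have S: "open ?S" by (rule open_chart_image[OF V U])
  have "smooth_map_on A (U \<inter> V) ?w"
    using V by (intro sm[of V "\<lambda>p X. THE w. X = chart_vector A V \<phi> p w"]) (force simp: tangent_bundle_def)
  from smooth_map_on_chart[OF this V] have w: "Cinf_on ?S (\<lambda>x. ?w (inv_into V \<phi> x))"
    by (simp add: Int_assoc)
  have cf: "Cinf_on (\<phi> ` V) ?f"
    using smooth_map_on_chart[of UNIV f V \<phi>] V f by (auto simp: smooth_functions_def o_def)
  have "Cinf_on ?S (\<lambda>x. frechet_derivative ?f (at x) b)" for b
    by (rule Cinf_on_subset[OF Cinf_on_frechet_derivative[OF cf]]) auto
  then have "Cinf_on ?S (\<lambda>x. \<Sum>b\<in>B. (?w (inv_into V \<phi> x) \<bullet> b) * frechet_derivative ?f (at x) b)"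
    by (intro Cinf_on_sum Cinf_on_bilinear[OF bounded_bilinear_mult] S
      Cinf_on_bounded_linear[OF bounded_linear_inner_left _ w])
  moreover have "(\<Sum>b\<in>B. (?w (inv_into V \<phi> x) \<bullet> b) * frechet_derivative ?f (at x) b) = X (inv_into V \<phi> x) f"
    if x: "x \<in> ?S" for x
  proof -
    obtain p where p: "p \<in> U" "p \<in> V" "x = \<phi> p" using x by auto
    have lin: "linear (frechet_derivative ?f (at (\<phi> p)))"
      using Cinf_on_has_derivative[OF cf, of "\<phi> p"] p has_derivative_linear by blast
    have "X p f = frechet_derivative ?f (at (\<phi> p)) (?w p)"
      using fun_cong[OF tangent_vector_chart[OF X[OF p(1)] V p(2)], of f] f by (simp add: chart_vector_def)
    also have "\<dots> = frechet_derivative ?f (at (\<phi> p)) (\<Sum>b\<in>B. (?w p \<bullet> b) *\<^sub>R b)"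
      using B by (simp add: orthonormal_basis_def)
    also have "\<dots> = (\<Sum>b\<in>B. (?w p \<bullet> b) * frechet_derivative ?f (at (\<phi> p)) b)"
      using lin by (simp add: linear_sum linear_cmul)
    finally show ?thesis using p chartD(4)[OF V] by simp
  qed
  ultimately show "Cinf_on ?S (\<lambda>x. X (inv_into V \<phi> x) f)"
    by (rule iffD1[OF Cinf_on_cong[OF S], rotated])
qed

end

section \<open>Sections, one-forms and frames\<close>

lemma sum_fun_apply: "(\<Sum>i\<in>I. f i) x = (\<Sum>i\<in>I. f i x)"
  for f :: "'i \<Rightarrow> 'b \<Rightarrow> 'c::comm_monoid_add"
  by (induction I rule: infinite_finite_induct) auto

lemma rlinear_on_sum:
  assumes "rlinear_on S F" "subspace S" "\<And>i. i \<in> I \<Longrightarrow> x i \<in> S"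
  shows "F (\<Sum>i\<in>I. c i *\<^sub>R x i) = (\<Sum>i\<in>I. c i *\<^sub>R F (x i))"
  using assms(3)
proof (induction I rule: infinite_finite_induct)
  case (insert i I)
  then have "(\<Sum>i\<in>I. c i *\<^sub>R x i) \<in> S" "c i *\<^sub>R x i \<in> S"
    using assms(2) by (auto intro!: subspace_sum subspace_scale)
  then show ?case using insert assms(1) by (simp add: rlinear_on_def)
next
  case empty
  \<comment> \<open>Homogeneity with the scalar 0 yields F(0) = 0.\<close>
  have "F (0 *\<^sub>R 0) = 0 *\<^sub>R F 0" using assms(1) subspace_0[OF assms(2)] unfolding rlinear_on_def by blast
  then show ?case by simp
next
  case (infinite I)
  have "F (0 *\<^sub>R 0) = 0 *\<^sub>R F 0" using assms(1) subspace_0[OF assms(2)] unfolding rlinear_on_def by blast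
  then show ?case using infinite by simp
qed

lemma rlinear_onD:
  assumes "rlinear_on S F"
  shows "x \<in> S \<Longrightarrow> y \<in> S \<Longrightarrow> F (x + y) = F x + F y" "x \<in> S \<Longrightarrow> F (c *\<^sub>R x) = c *\<^sub>R F x"
  using assms unfolding rlinear_on_def by blast+

lemma rlinear_on_0: "rlinear_on S F \<Longrightarrow> subspace S \<Longrightarrow> F 0 = 0"
  using rlinear_on_sum[of S F "{}"] by simp

text \<open>Shared by sections and one-forms, so that linearity over finite sums is proved once for
  both.\<close>

definition section_module :: "('m::topological_space, 'a::real_inner) atlas \<Rightarrow> ('m \<Rightarrow> 'v::real_vector) set \<Rightarrow> bool"
  where "section_module A S \<longleftrightarrow> 0 \<in> S \<and> (\<forall>s\<in>S. \<forall>t\<in>S. s + t \<in> S) \<and>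
    (\<forall>f\<in>smooth_functions A. \<forall>s\<in>S. f \<odot> s \<in> S)"

lemma section_module_sum:
  assumes "section_module A S" "\<And>i. i \<in> I \<Longrightarrow> f i \<in> smooth_functions A \<and> s i \<in> S"
  shows "(\<Sum>i\<in>I. f i \<odot> s i) \<in> S"
  using assms(2)
  by (induction I rule: infinite_finite_induct) (use assms(1) in \<open>auto simp: section_module_def\<close>)

section \<open>Maps linear over smooth functions: finite sums and locality\<close>

context smooth_mfd
begin

lemma Cinf_linear_0:
  assumes "Cinf_linear A S T F" "s \<in> S"
  shows "F 0 = 0"
proof -
  have "F ((\<lambda>_. 0) \<odot> s) = (\<lambda>_. 0) \<odot> F s"
    using assms smooth_functions_const unfolding Cinf_linear_def by blast
  then show ?thesis by (simp add: smult_def zero_fun_def)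
qed

lemma Cinf_linear_sum:
  fixes s :: "'i \<Rightarrow> 'm \<Rightarrow> 'v::real_vector" and F :: "('m \<Rightarrow> 'v) \<Rightarrow> 'm \<Rightarrow> 'w::real_vector"
  assumes F: "Cinf_linear A S T F" and S: "section_module A S"
    and "\<And>i. i \<in> I \<Longrightarrow> f i \<in> smooth_functions A \<and> s i \<in> S"
  shows "F (\<Sum>i\<in>I. f i \<odot> s i) = (\<Sum>i\<in>I. f i \<odot> F (s i))"
  using assms(3)
proof (induction I rule: infinite_finite_induct)
  case (insert i I)
  let ?r = "\<Sum>i\<in>I. f i \<odot> s i"
  have r: "?r \<in> S" using insert.prems by (intro section_module_sum[OF S]) auto
  have i: "f i \<in> smooth_functions A" "s i \<in> S" using insert.prems by auto
  then have m: "f i \<odot> s i \<in> S" using S by (auto simp: section_module_def)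
  have "F (\<Sum>i\<in>insert i I. f i \<odot> s i) = F (f i \<odot> s i + ?r)"
    by (subst sum.insert[OF insert.hyps]) (rule refl)
  also have "\<dots> = F (f i \<odot> s i) + F ?r"
    using F m r unfolding Cinf_linear_def by blast
  also have "F (f i \<odot> s i) = f i \<odot> F (s i)"
    using F i unfolding Cinf_linear_def by blast
  also have "F ?r = (\<Sum>i\<in>I. f i \<odot> F (s i))"
    by (rule insert.IH) (use insert.prems in blast)
  also have "f i \<odot> F (s i) + \<dots> = (\<Sum>i\<in>insert i I. f i \<odot> F (s i))"
    by (rule sum.insert[OF insert.hyps, symmetric])
  finally show ?case .
next
  case empty
  have "0 \<in> S" using S by (simp add: section_module_def)
  from Cinf_linear_0[OF F this] show ?case by (simp only: sum.empty)
next
  case (infinite I)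
  have "0 \<in> S" using S by (simp add: section_module_def)
  from Cinf_linear_0[OF F this] show ?case unfolding sum.infinite[OF infinite.hyps] .
qed

text \<open>With a bump function supported in \<open>U\<close>, the products with \<open>s\<close>
  and \<open>t\<close> are the same global section; linearity moves the bump function outside
  \<open>F\<close>, and at \<open>p\<close> it equals 1.\<close>

lemma Cinf_linear_local:
  assumes F: "Cinf_linear A S T F" and "s \<in> S" "t \<in> S"
    and U: "open U" "p \<in> U" "\<And>q. q \<in> U \<Longrightarrow> s q = t q"
  shows "F s p = F t p"
proof -
  obtain \<eta> W C where b: "\<eta> \<in> smooth_functions A" "open W" "p \<in> W" "W \<subseteq> U" "closed C" "C \<subseteq> U"
    "\<And>q. q \<in> W \<Longrightarrow> \<eta> q = 1" "\<And>q. q \<notin> C \<Longrightarrow> \<eta> q = 0"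
    using bump_function[OF U(1,2)] by blast
  have hom: "F (\<eta> \<odot> r) = \<eta> \<odot> F r" if "r \<in> S" for r
    using F that b(1) unfolding Cinf_linear_def by blast
  have "\<eta> q *\<^sub>R s q = \<eta> q *\<^sub>R t q" for q
    using b(6,8) U(3) by (cases "q \<in> U") auto
  then have "\<eta> \<odot> s = \<eta> \<odot> t" unfolding smult_def by (rule ext)
  then have "\<eta> \<odot> F s = \<eta> \<odot> F t" using hom[OF assms(2)] hom[OF assms(3)] by metis
  then have "(\<eta> \<odot> F s) p = (\<eta> \<odot> F t) p" by simp
  then show ?thesis using b by (simp add: smult_def)
qed

end

section \<open>Sections and one-forms of a vector bundle\<close>

locale smooth_vb = smooth_mfd A
  for A :: "('m::{t2_space,second_countable_topology}, 'a::real_inner) atlas" +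
  fixes E :: "('m, 'v::real_vector, 'k::real_inner) vbundle"
  assumes vb: "vector_bundle A E"
begin

lemma finite_dimensional_fibre: "finite_dimensional_type TYPE('k)"
  using vb unfolding vector_bundle_def by (elim conjE)

lemma subspace_fibre: "subspace (fibre E p)"
  using vb unfolding vector_bundle_def by (elim conjE) (rule spec)

lemma triv_at: obtains U \<Phi> where "(U, \<Phi>) \<in> trivs E" "p \<in> U"
proof -
  have "(\<Union>(U, \<Phi>)\<in>trivs E. U) = UNIV" using vb unfolding vector_bundle_def by (elim conjE)
  then have "p \<in> (\<Union>(U, \<Phi>)\<in>trivs E. U)" by simp
  then show thesis using that by auto
qed

lemma trivD:
  assumes "(U, \<Phi>) \<in> trivs E"
  shows "open U" "p \<in> U \<Longrightarrow> rlinear_on (fibre E p) (\<Phi> p)" "p \<in> U \<Longrightarrow> bij_betw (\<Phi> p) (fibre E p) UNIV"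
proof -
  have "\<forall>(U, \<Phi>)\<in>trivs E. open U \<and>
      (\<forall>p\<in>U. rlinear_on (fibre E p) (\<Phi> p) \<and> bij_betw (\<Phi> p) (fibre E p) UNIV)"
    using vb unfolding vector_bundle_def by (elim conjE)
  from bspec[OF this assms] show "open U" "p \<in> U \<Longrightarrow> rlinear_on (fibre E p) (\<Phi> p)"
    "p \<in> U \<Longrightarrow> bij_betw (\<Phi> p) (fibre E p) UNIV"
    by simp_all
qed

lemma triv_transition:
  assumes "(U, \<Phi>) \<in> trivs E" "(U', \<Phi>') \<in> trivs E"
  shows "smooth_map_on A (U \<inter> U') (\<lambda>p. \<Phi>' p (triv_inv E \<Phi> p y))"
proof -
  have "\<forall>(U, \<Phi>)\<in>trivs E. \<forall>(U', \<Phi>')\<in>trivs E. \<forall>y.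
      smooth_map_on A (U \<inter> U') (\<lambda>p. \<Phi>' p (triv_inv E \<Phi> p y))"
    using vb unfolding vector_bundle_def by (elim conjE)
  from bspec[OF this assms(1)] show ?thesis using assms(2) by fast
qed

lemma triv_inv:
  assumes "(U, \<Phi>) \<in> trivs E" "p \<in> U"
  shows "triv_inv E \<Phi> p y \<in> fibre E p" "\<Phi> p (triv_inv E \<Phi> p y) = y"
    "w \<in> fibre E p \<Longrightarrow> triv_inv E \<Phi> p (\<Phi> p w) = w" "linear (triv_inv E \<Phi> p)"
proof -
  note b = trivD(3)[OF assms] and l = trivD(2)[OF assms]
  have y: "y \<in> \<Phi> p ` fibre E p" for y using b by (simp add: bij_betw_def)
  show f: "triv_inv E \<Phi> p y \<in> fibre E p" for y
    unfolding triv_inv_def by (rule inv_into_into[OF y])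
  show i: "\<Phi> p (triv_inv E \<Phi> p y) = y" for y
    unfolding triv_inv_def by (rule f_inv_into_f[OF y])
  show j: "triv_inv E \<Phi> p (\<Phi> p w) = w" if "w \<in> fibre E p" for w
    unfolding triv_inv_def using b that by (simp add: bij_betw_def)
  show "linear (triv_inv E \<Phi> p)"
  proof (rule linearI)
    fix x y c
    have "triv_inv E \<Phi> p x + triv_inv E \<Phi> p y \<in> fibre E p"
      by (intro subspace_add subspace_fibre f)
    then show "triv_inv E \<Phi> p (x + y) = triv_inv E \<Phi> p x + triv_inv E \<Phi> p y"
      using j[of "triv_inv E \<Phi> p x + triv_inv E \<Phi> p y"] rlinear_onD(1)[OF l f f] i by simp
    have "c *\<^sub>R triv_inv E \<Phi> p x \<in> fibre E p"
      by (intro subspace_scale subspace_fibre f)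
    then show "triv_inv E \<Phi> p (c *\<^sub>R x) = c *\<^sub>R triv_inv E \<Phi> p x"
      using j[of "c *\<^sub>R triv_inv E \<Phi> p x"] rlinear_onD(2)[OF l f] i by simp
  qed
qed

lemma sectionsD:
  assumes "s \<in> sections A E"
  shows "s p \<in> fibre E p" "(U, \<Phi>) \<in> trivs E \<Longrightarrow> smooth_map_on A U (\<lambda>p. \<Phi> p (s p))"
  using assms by (auto simp: sections_def)

lemma sectionsI:
  assumes "\<And>p. s p \<in> fibre E p" "\<And>U \<Phi>. (U, \<Phi>) \<in> trivs E \<Longrightarrow> smooth_map_on A U (\<lambda>p. \<Phi> p (s p))"
  shows "s \<in> sections A E"
  using assms by (auto simp: sections_def)

lemma sections_module: "section_module A (sections A E)"
  unfolding section_module_def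
proof (intro conjI ballI)
  note sub = subspace_fibre
  show "0 \<in> sections A E"
  proof (rule sectionsI)
    fix U \<Phi> assume t: "(U, \<Phi>) \<in> trivs E"
    show "smooth_map_on A U (\<lambda>p. \<Phi> p (0 p))"
      by (rule smooth_map_on_cong[OF trivD(1)[OF t] _ smooth_map_on_const[of _ 0]])
        (simp add: rlinear_on_0[OF trivD(2)[OF t] sub])
  qed (simp add: subspace_0[OF sub])
  show "s + t \<in> sections A E" if st: "s \<in> sections A E" "t \<in> sections A E" for s t
  proof (rule sectionsI)
    fix U \<Phi> assume tr: "(U, \<Phi>) \<in> trivs E"
    show "smooth_map_on A U (\<lambda>p. \<Phi> p ((s + t) p))"
      by (rule smooth_map_on_cong[OF trivD(1)[OF tr] _ smooth_map_on_add[OF trivD(1)[OF tr]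
              sectionsD(2)[OF st(1) tr] sectionsD(2)[OF st(2) tr]]])
        (simp add: rlinear_onD(1)[OF trivD(2)[OF tr]] sectionsD(1)[OF st(1)] sectionsD(1)[OF st(2)])
  qed (simp add: subspace_add[OF sub] sectionsD(1)[OF st(1)] sectionsD(1)[OF st(2)])
  show "f \<odot> s \<in> sections A E" if f: "f \<in> smooth_functions A" and s: "s \<in> sections A E" for f s
  proof (rule sectionsI)
    fix U \<Phi> assume tr: "(U, \<Phi>) \<in> trivs E"
    show "smooth_map_on A U (\<lambda>p. \<Phi> p ((f \<odot> s) p))"
      by (rule smooth_map_on_cong[OF trivD(1)[OF tr] _ smooth_map_on_scaleR[OF trivD(1)[OF tr]
              smooth_functionsD[OF f trivD(1)[OF tr]] sectionsD(2)[OF s tr]]])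
        (simp add: smult_def rlinear_onD(2)[OF trivD(2)[OF tr]] sectionsD(1)[OF s])
  qed (simp add: smult_def subspace_scale[OF sub] sectionsD(1)[OF s])
qed

lemma sections_add: "s \<in> sections A E \<Longrightarrow> t \<in> sections A E \<Longrightarrow> s + t \<in> sections A E"
  and sections_smult: "f \<in> smooth_functions A \<Longrightarrow> s \<in> sections A E \<Longrightarrow> f \<odot> s \<in> sections A E"
  using sections_module by (auto simp: section_module_def)

lemma sections_uminus: "s \<in> sections A E \<Longrightarrow> - s \<in> sections A E"
  using sections_smult[OF smooth_functions_const[of "-1"], of s] by (simp add: smult_def fun_Compl_def)

lemma sections_diff: "s \<in> sections A E \<Longrightarrow> t \<in> sections A E \<Longrightarrow> s - t \<in> sections A E"
  using sections_add[OF _ sections_uminus, of s t] by simp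

text \<open>Meant for objects defined pointwise, such as the contraction, which near each point
  agree with some global section.\<close>

lemma sections_local:
  assumes "\<And>p. \<exists>W t. open W \<and> p \<in> W \<and> t \<in> sections A E \<and> (\<forall>q\<in>W. s q = t q)"
  shows "s \<in> sections A E"
proof (rule sectionsI)
  show "s p \<in> fibre E p" for p using assms[of p] sectionsD(1) by fastforce
  fix U \<Phi> assume tr: "(U, \<Phi>) \<in> trivs E"
  show "smooth_map_on A U (\<lambda>p. \<Phi> p (s p))"
  proof (rule smooth_map_on_local)
    fix p assume "p \<in> U"
    obtain W t where W: "open W" "p \<in> W" "t \<in> sections A E" "\<forall>q\<in>W. s q = t q" using assms by blast
    have o: "open (U \<inter> W)" using W(1) trivD(1)[OF tr] by blast
    have "smooth_map_on A (U \<inter> W) (\<lambda>p. \<Phi> p (s p))"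
      by (rule smooth_map_on_cong[OF o _ smooth_map_on_subset[OF sectionsD(2)[OF W(3) tr]]]) (use W in auto)
    then show "\<exists>W. open W \<and> p \<in> W \<and> smooth_map_on A W (\<lambda>p. \<Phi> p (s p))" using o \<open>p \<in> U\<close> W(2) by blast
  qed
qed

lemma fibre_expand:
  assumes "(U, \<Phi>) \<in> trivs E" "p \<in> U" "orthonormal_basis B" "w \<in> fibre E p"
  shows "(\<Sum>b\<in>B. (\<Phi> p w \<bullet> b) *\<^sub>R triv_inv E \<Phi> p b) = w"
proof -
  have "triv_inv E \<Phi> p (\<Sum>b\<in>B. (\<Phi> p w \<bullet> b) *\<^sub>R b) = (\<Sum>b\<in>B. (\<Phi> p w \<bullet> b) *\<^sub>R triv_inv E \<Phi> p b)"
    using triv_inv(4)[OF assms(1,2)] by (simp add: linear_sum linear_cmul)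
  then show ?thesis using assms(3) triv_inv(3)[OF assms(1,2,4)] by (simp add: orthonormal_basis_def)
qed

text \<open>Over a trivialization the value is a sum of coordinates of \<open>s\<close> times values
  of \<open>F\<close> on the images of constant vectors. A general fibrewise linear \<open>F\<close>
  serves both the pairing with one-forms and u \<mapsto> \<rho>(u)(f).\<close>

lemma smooth_fibre_linear:
  fixes F :: "'m \<Rightarrow> 'v \<Rightarrow> real"
  assumes F: "\<And>p. rlinear_on (fibre E p) (F p)"
    and sm: "\<And>U \<Phi> y. (U, \<Phi>) \<in> trivs E \<Longrightarrow> smooth_map_on A U (\<lambda>p. F p (triv_inv E \<Phi> p y))"
    and s: "s \<in> sections A E"
  shows "(\<lambda>p. F p (s p)) \<in> smooth_functions A"
  unfolding smooth_functions_def
proof (intro CollectI smooth_map_on_local)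
  fix p
  obtain U \<Phi> where tr: "(U, \<Phi>) \<in> trivs E" "p \<in> U" using triv_at .
  obtain B :: "'k set" where B: "orthonormal_basis B"
    using finite_dimensional_orthonormal_basis[OF finite_dimensional_fibre] .
  note o = trivD(1)[OF tr(1)]
  have "smooth_map_on A U (\<lambda>p. \<Sum>b\<in>B. (\<Phi> p (s p) \<bullet> b) * F p (triv_inv E \<Phi> p b))"
    by (intro smooth_map_on_sum[OF o] smooth_map_on_mult[OF o
        smooth_map_on_inner[OF o sectionsD(2)[OF s tr(1)] smooth_map_on_const] sm[OF tr(1)]])
  moreover have "(\<Sum>b\<in>B. (\<Phi> p (s p) \<bullet> b) * F p (triv_inv E \<Phi> p b)) = F p (s p)" if "p \<in> U" for p
  proof -
    have "F p (\<Sum>b\<in>B. (\<Phi> p (s p) \<bullet> b) *\<^sub>R triv_inv E \<Phi> p b) = (\<Sum>b\<in>B. (\<Phi> p (s p) \<bullet> b) *\<^sub>R F p (triv_inv E \<Phi> p b))"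
      by (rule rlinear_on_sum[OF F subspace_fibre]) (rule triv_inv(1)[OF tr(1) that])
    then show ?thesis using fibre_expand[OF tr(1) that B sectionsD(1)[OF s]] by simp
  qed
  ultimately have "smooth_map_on A U (\<lambda>p. F p (s p))"
    by (rule smooth_map_on_cong[OF o, rotated])
  then show "\<exists>W. open W \<and> p \<in> W \<and> smooth_map_on A W (\<lambda>p. F p (s p))" using o tr by blast
qed

text \<open>Riesz representation in a trivialization: the representing vector is written down in an
  orthonormal basis, and surjectivity of the trivialization makes it unique, so the definite
  description in \<open>dual_bundle\<close> is meaningful.\<close>

lemma dual_coordinates:
  assumes tr: "(U, \<Phi>) \<in> trivs E" "p \<in> U" and \<alpha>: "rlinear_on (fibre E p) \<alpha>" and B: "orthonormal_basis B"
  shows "(THE k. \<forall>w\<in>fibre E p. \<alpha> w = k \<bullet> \<Phi> p w) = (\<Sum>b\<in>B. \<alpha> (triv_inv E \<Phi> p b) *\<^sub>R b)" (is "_ = ?k")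
    and "w \<in> fibre E p \<Longrightarrow> \<alpha> w = (THE k. \<forall>w\<in>fibre E p. \<alpha> w = k \<bullet> \<Phi> p w) \<bullet> \<Phi> p w"
proof -
  have *: "\<alpha> w = ?k \<bullet> \<Phi> p w" if "w \<in> fibre E p" for w
  proof -
    have "\<alpha> (\<Sum>b\<in>B. (\<Phi> p w \<bullet> b) *\<^sub>R triv_inv E \<Phi> p b) = (\<Sum>b\<in>B. (\<Phi> p w \<bullet> b) *\<^sub>R \<alpha> (triv_inv E \<Phi> p b))"
      by (rule rlinear_on_sum[OF \<alpha> subspace_fibre]) (rule triv_inv(1)[OF tr])
    then have "\<alpha> w = (\<Sum>b\<in>B. (\<Phi> p w \<bullet> b) * \<alpha> (triv_inv E \<Phi> p b))"
      using fibre_expand[OF tr B that] by simp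
    then show ?thesis by (simp add: inner_sum_left inner_commute[of "\<Phi> p w"] mult.commute)
  qed
  show eq: "(THE k. \<forall>w\<in>fibre E p. \<alpha> w = k \<bullet> \<Phi> p w) = ?k"
  proof (rule the_equality)
    fix k assume k: "\<forall>w\<in>fibre E p. \<alpha> w = k \<bullet> \<Phi> p w"
    have "k \<bullet> y = ?k \<bullet> y" for y
      using bspec[OF k triv_inv(1)[OF tr, of y]] *[OF triv_inv(1)[OF tr, of y]] triv_inv(2)[OF tr, of y]
      by simp
    then show "k = ?k" using vector_eq_rdot by blast
  qed (use * in blast)
  show "w \<in> fibre E p \<Longrightarrow> \<alpha> w = (THE k. \<forall>w\<in>fibre E p. \<alpha> w = k \<bullet> \<Phi> p w) \<bullet> \<Phi> p w"
    unfolding eq by (rule *)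
qed

text \<open>The third part tests smoothness on images of constant vectors. Together with
  \<open>one_formsI\<close> it frees all later arguments from the definite description in the dual
  trivializations.\<close>

lemma one_formsD:
  assumes "\<alpha> \<in> one_forms A E"
  shows "rlinear_on (fibre E p) (\<alpha> p)" "w \<notin> fibre E p \<Longrightarrow> \<alpha> p w = 0"
    "(U, \<Phi>) \<in> trivs E \<Longrightarrow> smooth_map_on A U (\<lambda>p. \<alpha> p (triv_inv E \<Phi> p y))"
proof -
  have *: "\<alpha> p \<in> fibre (dual_bundle E) p" for p using assms by (simp add: sections_def)
  then show l: "rlinear_on (fibre E p) (\<alpha> p)" and "w \<notin> fibre E p \<Longrightarrow> \<alpha> p w = 0" for p w
    by (auto simp: dual_bundle_def)
  assume tr: "(U, \<Phi>) \<in> trivs E"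
  let ?k = "\<lambda>p \<alpha>. THE k. \<forall>w\<in>fibre E p. \<alpha> w = k \<bullet> \<Phi> p w"
  obtain B :: "'k set" where B: "orthonormal_basis B"
    using finite_dimensional_orthonormal_basis[OF finite_dimensional_fibre] .
  have "(U, ?k) \<in> trivs (dual_bundle E)" using tr by (force simp: dual_bundle_def)
  then have "smooth_map_on A U (\<lambda>p. ?k p (\<alpha> p))" using assms by (auto simp: sections_def)
  then have "smooth_map_on A U (\<lambda>p. ?k p (\<alpha> p) \<bullet> y)"
    by (rule smooth_map_on_inner[OF trivD(1)[OF tr] _ smooth_map_on_const])
  moreover have "?k p (\<alpha> p) \<bullet> y = \<alpha> p (triv_inv E \<Phi> p y)" if "p \<in> U" for p
    using dual_coordinates(2)[OF tr that l B triv_inv(1)[OF tr that]] triv_inv(2)[OF tr that] by simp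
  ultimately show "smooth_map_on A U (\<lambda>p. \<alpha> p (triv_inv E \<Phi> p y))"
    by (rule smooth_map_on_cong[OF trivD(1)[OF tr], rotated])
qed

lemma one_formsI:
  assumes l: "\<And>p. rlinear_on (fibre E p) (\<alpha> p)" and z: "\<And>p w. w \<notin> fibre E p \<Longrightarrow> \<alpha> p w = 0"
    and sm: "\<And>U \<Phi> y. (U, \<Phi>) \<in> trivs E \<Longrightarrow> smooth_map_on A U (\<lambda>p. \<alpha> p (triv_inv E \<Phi> p y))"
  shows "\<alpha> \<in> one_forms A E"
proof -
  obtain B :: "'k set" where B: "orthonormal_basis B"
    using finite_dimensional_orthonormal_basis[OF finite_dimensional_fibre] .
  have "smooth_map_on A U (\<lambda>p. THE k. \<forall>w\<in>fibre E p. \<alpha> p w = k \<bullet> \<Phi> p w)" if tr: "(U, \<Phi>) \<in> trivs E" for U \<Phi>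
  proof -
    note o = trivD(1)[OF tr]
    have "smooth_map_on A U (\<lambda>p. \<Sum>b\<in>B. \<alpha> p (triv_inv E \<Phi> p b) *\<^sub>R b)"
      by (intro smooth_map_on_sum[OF o] smooth_map_on_scaleR[OF o sm[OF tr] smooth_map_on_const])
    then show ?thesis
      by (rule smooth_map_on_cong[OF o, rotated]) (rule dual_coordinates(1)[OF tr _ l B, symmetric])
  qed
  then show ?thesis using l z by (auto simp: sections_def dual_bundle_def)
qed

lemma one_forms_module: "section_module A (one_forms A E)"
  unfolding section_module_def
proof (intro conjI ballI)
  show "0 \<in> one_forms A E"
    by (rule one_formsI) (auto simp: rlinear_on_def smooth_map_on_const)
  show "s + t \<in> one_forms A E" if st: "s \<in> one_forms A E" "t \<in> one_forms A E" for s t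
  proof (rule one_formsI)
    fix U \<Phi> y assume tr: "(U, \<Phi>) \<in> trivs E"
    show "smooth_map_on A U (\<lambda>p. (s + t) p (triv_inv E \<Phi> p y))"
      using smooth_map_on_add[OF trivD(1)[OF tr] one_formsD(3)[OF st(1) tr] one_formsD(3)[OF st(2) tr]]
      by simp
  qed (use one_formsD[OF st(1)] one_formsD[OF st(2)] in \<open>auto simp: rlinear_on_def algebra_simps\<close>)
  show "f \<odot> s \<in> one_forms A E" if f: "f \<in> smooth_functions A" and s: "s \<in> one_forms A E" for f s
  proof (rule one_formsI)
    fix U \<Phi> y assume tr: "(U, \<Phi>) \<in> trivs E"
    show "smooth_map_on A U (\<lambda>p. (f \<odot> s) p (triv_inv E \<Phi> p y))"
      using smooth_map_on_mult[OF trivD(1)[OF tr] smooth_functionsD[OF f trivD(1)[OF tr]] one_formsD(3)[OF s tr]]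
      by (simp add: smult_def scaleR_fun_def)
  qed (use one_formsD[OF s] in \<open>auto simp: rlinear_on_def algebra_simps smult_def scaleR_fun_def\<close>)
qed

lemma pairing_smooth:
  "\<alpha> \<in> one_forms A E \<Longrightarrow> s \<in> sections A E \<Longrightarrow> (\<lambda>p. \<alpha> p (s p)) \<in> smooth_functions A"
  by (rule smooth_fibre_linear[OF one_formsD(1) one_formsD(3)])

section \<open>Frame expansions and the existence of frames\<close>

lemma frame_expand:
  assumes fr: "frame_coframe_on A E U X e" "p \<in> U" and w: "w \<in> fibre E p"
  shows "(\<Sum>a<vb_rank E. e a p w *\<^sub>R X a p) = w"
proof -
  let ?n = "vb_rank E"
  have X: "X a \<in> sections A E" "e a \<in> one_forms A E" if "a < ?n" for a
    using fr(1) that by (auto simp: frame_coframe_on_def)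
  have sp: "span ((\<lambda>a. X a p) ` {..<?n}) = fibre E p" and inj: "inj_on (\<lambda>a. X a p) {..<?n}"
    using fr by (auto simp: frame_coframe_on_def)
  have d: "e a p (X b p) = (if a = b then 1 else 0)" if "a < ?n" "b < ?n" for a b
    using fr that by (auto simp: frame_coframe_on_def)
  obtain u where "w = (\<Sum>x\<in>(\<lambda>a. X a p) ` {..<?n}. u x *\<^sub>R x)"
    using w unfolding sp[symmetric] by (auto simp: span_finite)
  then have u: "w = (\<Sum>a<?n. u (X a p) *\<^sub>R X a p)" by (simp add: sum.reindex[OF inj])
  have "e a p w = u (X a p)" if a: "a < ?n" for a
  proof -
    have "e a p w = (\<Sum>b<?n. u (X b p) *\<^sub>R e a p (X b p))"
      unfolding u by (rule rlinear_on_sum[OF one_formsD(1)[OF X(2)[OF a]] subspace_fibre])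
        (simp add: sectionsD(1) X(1))
    also have "\<dots> = (\<Sum>b<?n. if b = a then u (X a p) else 0)"
      by (intro sum.cong) (auto simp: d a)
    finally show ?thesis using a by simp
  qed
  then have "(\<Sum>a<?n. e a p w *\<^sub>R X a p) = (\<Sum>a<?n. u (X a p) *\<^sub>R X a p)" by (intro sum.cong) auto
  then show ?thesis using u by simp
qed

lemma coframe_expand:
  assumes fr: "frame_coframe_on A E U X e" "p \<in> U" and \<alpha>: "\<alpha> \<in> one_forms A E"
  shows "(\<Sum>a<vb_rank E. \<alpha> p (X a p) *\<^sub>R e a p) = \<alpha> p"
proof
  fix w
  let ?n = "vb_rank E"
  have X: "X a \<in> sections A E" "e a \<in> one_forms A E" if "a < ?n" for a
    using fr(1) that by (auto simp: frame_coframe_on_def)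
  show "(\<Sum>a<?n. \<alpha> p (X a p) *\<^sub>R e a p) w = \<alpha> p w"
  proof (cases "w \<in> fibre E p")
    case True
    have "\<alpha> p (\<Sum>a<?n. e a p w *\<^sub>R X a p) = (\<Sum>a<?n. e a p w *\<^sub>R \<alpha> p (X a p))"
      by (rule rlinear_on_sum[OF one_formsD(1)[OF \<alpha>] subspace_fibre]) (simp add: sectionsD(1) X(1))
    then show ?thesis
      using frame_expand[OF fr True] by (simp add: sum_fun_apply scaleR_fun_def mult.commute)
  \<comment> \<open>Outside the fibre both sides are 0 by the convention for covectors; this makes
    the equality hold as functions on the whole ambient space.\<close>
  next
    case False
    then show ?thesis
      using one_formsD(2)[OF \<alpha>] one_formsD(2)[OF X(2)] by (simp add: sum_fun_apply scaleR_fun_def)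
  qed
qed

text \<open>The expansion of \<open>s\<close> is valid only on \<open>U\<close>, but
  \<open>X\<close>, \<open>e\<close> and hence the coefficients are global. Their combination is a
  global section that agrees with \<open>s\<close> near \<open>p\<close>, so locality allows the
  replacement.\<close>

lemma Cinf_linear_frame:
  assumes fr: "frame_coframe_on A E U X e" "p \<in> U" and F: "Cinf_linear A (sections A E) T F"
    and s: "s \<in> sections A E"
  shows "F s p = (\<Sum>a<vb_rank E. e a p (s p) *\<^sub>R F (X a) p)"
proof -
  let ?n = "vb_rank E" and ?t = "\<Sum>a<vb_rank E. (\<lambda>q. e a q (s q)) \<odot> X a"
  have X: "X a \<in> sections A E" "e a \<in> one_forms A E" if "a < ?n" for a
    using fr(1) that by (auto simp: frame_coframe_on_def)
  then have m: "\<And>a. a \<in> {..<?n} \<Longrightarrow> (\<lambda>q. e a q (s q)) \<in> smooth_functions A \<and> X a \<in> sections A E"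
    using pairing_smooth s by simp
  have "F s p = F ?t p"
  proof (rule Cinf_linear_local[OF F s section_module_sum[OF sections_module m]])
    show "open U" using fr by (simp add: frame_coframe_on_def)
    show "s q = ?t q" if "q \<in> U" for q
      using frame_expand[OF fr(1) that sectionsD(1)[OF s]] by (simp add: sum_fun_apply smult_def)
  qed (use fr in auto)
  also have "F ?t = (\<Sum>a<?n. (\<lambda>q. e a q (s q)) \<odot> F (X a))"
    by (rule Cinf_linear_sum[OF F sections_module m])
  finally show ?thesis by (simp add: sum_fun_apply smult_def)
qed

lemma Cinf_linear_coframe:
  assumes fr: "frame_coframe_on A E U X e" "p \<in> U" and F: "Cinf_linear A (one_forms A E) T F"
    and \<alpha>: "\<alpha> \<in> one_forms A E"
  shows "F \<alpha> p = (\<Sum>a<vb_rank E. \<alpha> p (X a p) *\<^sub>R F (e a) p)"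
proof -
  let ?n = "vb_rank E" and ?t = "\<Sum>a<vb_rank E. (\<lambda>q. \<alpha> q (X a q)) \<odot> e a"
  have X: "X a \<in> sections A E" "e a \<in> one_forms A E" if "a < ?n" for a
    using fr(1) that by (auto simp: frame_coframe_on_def)
  then have m: "\<And>a. a \<in> {..<?n} \<Longrightarrow> (\<lambda>q. \<alpha> q (X a q)) \<in> smooth_functions A \<and> e a \<in> one_forms A E"
    using pairing_smooth \<alpha> by simp
  have "F \<alpha> p = F ?t p"
  proof (rule Cinf_linear_local[OF F \<alpha> section_module_sum[OF one_forms_module m]])
    show "open U" using fr by (simp add: frame_coframe_on_def)
    show "\<alpha> q = ?t q" if "q \<in> U" for q
      using coframe_expand[OF fr(1) that \<alpha>] by (simp add: sum_fun_apply smult_def)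
  qed (use fr in auto)
  also have "F ?t = (\<Sum>a<?n. (\<lambda>q. \<alpha> q (X a q)) \<odot> F (e a))"
    by (rule Cinf_linear_sum[OF F one_forms_module m])
  finally show ?thesis by (simp add: sum_fun_apply smult_def)
qed

text \<open>Frames are indexed by the numbers below \<open>vb_rank E\<close>, hence the enumeration.
  Orthonormality lets the same vectors define both frame and coframe.\<close>

lemma orthonormal_basis_enum:
  obtains b :: "nat \<Rightarrow> 'k" where "bij_betw b {..<vb_rank E} (b ` {..<vb_rank E})"
    "orthonormal_basis (b ` {..<vb_rank E})" "independent (b ` {..<vb_rank E})" "span (b ` {..<vb_rank E}) = UNIV"
proof -
  obtain B :: "'k set" where B: "orthonormal_basis B"
    using finite_dimensional_orthonormal_basis[OF finite_dimensional_fibre] .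
  then have f: "finite B" by (simp add: orthonormal_basis_def)
  have "b \<bullet> b = 1" if "b \<in> B" for b using B that by (simp add: orthonormal_basis_def)
  then have "0 \<notin> B" by force
  moreover have "pairwise orthogonal B"
    using B by (simp add: orthonormal_basis_def pairwise_def orthogonal_def)
  ultimately have i: "independent B" using pairwise_orthogonal_independent by blast
  have sp: "span B = UNIV"
  proof -
    have "x \<in> span B" for x
    proof -
      have "(\<Sum>b\<in>B. (x \<bullet> b) *\<^sub>R b) \<in> span B" by (intro span_sum span_scale span_base)
      then show ?thesis using B by (simp add: orthonormal_basis_def)
    qed
    then show ?thesis by blast
  qed
  have "card B = vb_rank E" unfolding vb_rank_def by (rule dim_unique[symmetric]) (use sp i in auto)
  then obtain b where b: "bij_betw b {..<vb_rank E} B"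
    using ex_bij_betw_nat_finite[OF f] by (auto simp: atLeast0LessThan)
  then have "b ` {..<vb_rank E} = B" by (simp add: bij_betw_def)
  then show thesis using that[of b] b B i sp by simp
qed

text \<open>Constant vectors in a trivialization, and inner products with them, are cut off by the
  same bump function. Duality holds only up to its square, which is 1 on \<open>W\<close>; so the
  frame is claimed on \<open>W\<close>, not on the trivialization domain.\<close>

lemma frame_exists: obtains W X e where "p \<in> W" "frame_coframe_on A E W X e"
proof -
  let ?n = "vb_rank E"
  obtain U \<Phi> where tr: "(U, \<Phi>) \<in> trivs E" "p \<in> U" using triv_at .
  note o = trivD(1)[OF tr(1)]
  obtain b :: "nat \<Rightarrow> 'k" where b: "bij_betw b {..<?n} (b ` {..<?n})"
    "orthonormal_basis (b ` {..<?n})" "independent (b ` {..<?n})" "span (b ` {..<?n}) = UNIV"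
    using orthonormal_basis_enum .
  obtain \<eta> W C where \<eta>: "\<eta> \<in> smooth_functions A" "open W" "p \<in> W" "W \<subseteq> U" "closed C" "C \<subseteq> U"
    "\<And>q. q \<in> W \<Longrightarrow> \<eta> q = 1" "\<And>q. q \<notin> C \<Longrightarrow> \<eta> q = 0"
    using bump_function[OF o tr(2)] by blast
  define X where "X a q = (if q \<in> U then \<eta> q *\<^sub>R triv_inv E \<Phi> q (b a) else 0)" for a q
  define e where "e a q w = (if q \<in> U \<and> w \<in> fibre E q then \<eta> q * (b a \<bullet> \<Phi> q w) else 0)" for a q w
  have "X a \<in> sections A E" for a
  proof (rule sectionsI)
    show "X a q \<in> fibre E q" for q
      using subspace_fibre[of q] triv_inv(1)[OF tr(1), of q]
      by (simp add: X_def subspace_scale subspace_0)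
    fix U' \<Phi>' assume tr': "(U', \<Phi>') \<in> trivs E"
    show "smooth_map_on A U' (\<lambda>q. \<Phi>' q (X a q))"
    proof (rule smooth_map_on_extend[OF o trivD(1)[OF tr'] \<eta>(5,6) triv_transition[OF tr(1) tr', of "b a"] \<eta>(1)])
      show "\<Phi>' q (X a q) = \<eta> q *\<^sub>R \<Phi>' q (triv_inv E \<Phi> q (b a))" if "q \<in> U \<inter> U'" for q
        using that rlinear_onD(2)[OF trivD(2)[OF tr'] triv_inv(1)[OF tr(1)]] by (simp add: X_def)
      show "\<Phi>' q (X a q) = 0" if "q \<in> U' - C" for q
        using that rlinear_on_0[OF trivD(2)[OF tr'] subspace_fibre] \<eta>(8) by (simp add: X_def)
    qed
  qed
  moreover have "e a \<in> one_forms A E" for a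
  proof (rule one_formsI)
    fix q
    show "rlinear_on (fibre E q) (e a q)"
      using trivD(2)[OF tr(1), of q] subspace_fibre[of q]
      by (auto simp: rlinear_on_def e_def subspace_scale subspace_add inner_add_right algebra_simps)
  next
    fix U' \<Phi>' y assume tr': "(U', \<Phi>') \<in> trivs E"
    have o': "open (U \<inter> U')" using o trivD(1)[OF tr'] by blast
    have "smooth_map_on A (U' \<inter> U) (\<lambda>q. \<Phi> q (triv_inv E \<Phi>' q y))" by (rule triv_transition[OF tr' tr(1)])
    then have "smooth_map_on A (U \<inter> U') (\<lambda>q. b a \<bullet> \<Phi> q (triv_inv E \<Phi>' q y))"
      by (intro smooth_map_on_inner[OF o' smooth_map_on_const]) (simp add: Int_commute)
    then show "smooth_map_on A U' (\<lambda>q. e a q (triv_inv E \<Phi>' q y))"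
    proof (rule smooth_map_on_extend[OF o trivD(1)[OF tr'] \<eta>(5,6) _ \<eta>(1)])
      show "e a q (triv_inv E \<Phi>' q y) = \<eta> q *\<^sub>R (b a \<bullet> \<Phi> q (triv_inv E \<Phi>' q y))" if "q \<in> U \<inter> U'" for q
        using that triv_inv(1)[OF tr'] by (simp add: e_def)
      show "e a q (triv_inv E \<Phi>' q y) = 0" if "q \<in> U' - C" for q
        using that \<eta>(8) by (simp add: e_def)
    qed
  qed (simp add: e_def)
  moreover have "inj_on (\<lambda>a. X a q) {..<?n} \<and> independent ((\<lambda>a. X a q) ` {..<?n}) \<and>
    span ((\<lambda>a. X a q) ` {..<?n}) = fibre E q \<and> (\<forall>a<?n. \<forall>c<?n. e a q (X c q) = (if a = c then 1 else 0))"
    if q: "q \<in> W" for q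
  proof -
    let ?T = "triv_inv E \<Phi> q"
    have qU: "q \<in> U" using q \<eta>(4) by blast
    note T = triv_inv[OF tr(1) qU]
    have Xq: "X a q = ?T (b a)" for a using qU \<eta>(7)[OF q] by (simp add: X_def)
    have inj: "inj ?T" using T(2) by (metis injI)
    have im: "(\<lambda>a. X a q) ` {..<?n} = ?T ` b ` {..<?n}" by (simp add: Xq image_image)
    have "inj_on (\<lambda>a. X a q) {..<?n}"
      using b(1) inj unfolding Xq bij_betw_def inj_on_def by blast
    moreover have "independent ((\<lambda>a. X a q) ` {..<?n})"
      unfolding im by (rule linear_independent_injective_image[OF T(4) b(3)]) (rule inj_on_subset[OF inj], simp)
    moreover have "span ((\<lambda>a. X a q) ` {..<?n}) = fibre E q"
    proof -
      have "span (?T ` b ` {..<?n}) = range ?T" using linear_span_image[OF T(4)] b(4) by simp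
      moreover have "range ?T = fibre E q" using T(1,3) by (auto simp: image_iff) metis
      ultimately show ?thesis unfolding im by simp
    qed
    moreover have "e a q (X c q) = (if a = c then 1 else 0)" if "a < ?n" "c < ?n" for a c
    proof -
      have "b a = b c \<longleftrightarrow> a = c" using b(1) that by (auto simp: bij_betw_def inj_on_def)
      moreover have "b a \<bullet> b c = (if b a = b c then 1 else 0)"
        using b(2) that by (auto simp: orthonormal_basis_def)
      ultimately show ?thesis using qU T(1,2) \<eta>(7)[OF q] by (simp add: e_def Xq)
    qed
    ultimately show ?thesis by blast
  qed
  ultimately have "frame_coframe_on A E W X e" using \<eta>(2) by (auto simp: frame_coframe_on_def)
  then show thesis using that \<eta>(3) by blast
qed

end

section \<open>The modified bracket\<close>

lemma smult_apply: "(f \<odot> s) p = f p *\<^sub>R s p"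
  by (simp add: smult_def)

section \<open>The anchor and the derivations it induces\<close>

locale anchored_vb = smooth_vb A E
  for A :: "('m::{t2_space,second_countable_topology}, 'a::real_inner) atlas"
    and E :: "('m, 'v::real_vector, 'k::real_inner) vbundle" +
  fixes \<rho> :: "('m, 'v) anchor"
  assumes anchor: "vb_morphism A E (tangent_bundle A) \<rho>"
begin

lemma anchorD:
  shows "w \<in> fibre E p \<Longrightarrow> \<rho> p w \<in> fibre (tangent_bundle A) p" "rlinear_on (fibre E p) (\<rho> p)"
    "(U, \<Phi>) \<in> trivs E \<Longrightarrow> (V, \<Psi>) \<in> trivs (tangent_bundle A)
      \<Longrightarrow> smooth_map_on A (U \<inter> V) (\<lambda>p. \<Psi> p (\<rho> p (triv_inv E \<Phi> p y)))"
proof -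
  have 1: "\<forall>p. \<rho> p ` fibre E p \<subseteq> fibre (tangent_bundle A) p \<and> rlinear_on (fibre E p) (\<rho> p)"
    using anchor unfolding vb_morphism_def by (elim conjE)
  have 2: "\<forall>(U, \<Phi>)\<in>trivs E. \<forall>(V, \<Psi>)\<in>trivs (tangent_bundle A). \<forall>y.
      smooth_map_on A (U \<inter> V) (\<lambda>p. \<Psi> p (\<rho> p (triv_inv E \<Phi> p y)))"
    using anchor unfolding vb_morphism_def by (elim conjE)
  from 1 show "w \<in> fibre E p \<Longrightarrow> \<rho> p w \<in> fibre (tangent_bundle A) p" "rlinear_on (fibre E p) (\<rho> p)"
    by blast+
  assume tr: "(U, \<Phi>) \<in> trivs E" and tr': "(V, \<Psi>) \<in> trivs (tangent_bundle A)"
  from bspec[OF 2 tr] show "smooth_map_on A (U \<inter> V) (\<lambda>p. \<Psi> p (\<rho> p (triv_inv E \<Phi> p y)))"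
    using tr' by fast
qed

lemma anchor_apply_linear: "rlinear_on (fibre E p) (\<lambda>w. \<rho> p w f)"
  using anchorD(2)[of p] by (simp add: rlinear_on_def scaleR_fun_def)

lemma anchor_apply_smooth:
  assumes tr: "(U, \<Phi>) \<in> trivs E" and f: "f \<in> smooth_functions A"
  shows "smooth_map_on A U (\<lambda>p. \<rho> p (triv_inv E \<Phi> p y) f)"
proof (rule smooth_derivative[where X = "\<lambda>p. \<rho> p (triv_inv E \<Phi> p y)", OF trivD(1)[OF tr] _ _ f])
  show "\<rho> p (triv_inv E \<Phi> p y) \<in> fibre (tangent_bundle A) p" if "p \<in> U" for p
    by (rule anchorD(1)[OF triv_inv(1)[OF tr that]])
qed (rule anchorD(3)[OF tr])

lemma anchor_der_smooth:
  "u \<in> sections A E \<Longrightarrow> f \<in> smooth_functions A \<Longrightarrow> anchor_der \<rho> u f \<in> smooth_functions A"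
  unfolding anchor_der_def anchor_sec_def
  by (rule smooth_fibre_linear[where F = "\<lambda>p w. \<rho> p w f", OF anchor_apply_linear anchor_apply_smooth])

lemma coboundary_one_form:
  assumes f: "f \<in> smooth_functions A"
  shows "coboundary E \<rho> f \<in> one_forms A E"
proof (rule one_formsI)
  show "rlinear_on (fibre E p) (coboundary E \<rho> f p)" for p
    using anchor_apply_linear[of p f] subspace_fibre[of p]
    by (simp add: rlinear_on_def coboundary_def subspace_add subspace_scale)
  show "smooth_map_on A U (\<lambda>p. coboundary E \<rho> f p (triv_inv E \<Phi> p y))" if tr: "(U, \<Phi>) \<in> trivs E" for U \<Phi> y
    by (rule smooth_map_on_cong[OF trivD(1)[OF tr] _ anchor_apply_smooth[OF tr f]])
      (simp add: coboundary_def triv_inv(1)[OF tr])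
qed (simp add: coboundary_def)

lemma anchor_sec_add:
  "u \<in> sections A E \<Longrightarrow> v \<in> sections A E \<Longrightarrow> anchor_sec \<rho> (u + v) = anchor_sec \<rho> u + anchor_sec \<rho> v"
  by (intro ext) (simp add: anchor_sec_def rlinear_onD(1)[OF anchorD(2)] sectionsD(1))

lemma anchor_sec_smult: "u \<in> sections A E \<Longrightarrow> anchor_sec \<rho> (f \<odot> u) = f \<odot> anchor_sec \<rho> u"
  by (rule ext) (simp add: anchor_sec_def smult_apply rlinear_onD(2)[OF anchorD(2)] sectionsD(1))

lemma anchor_der_sec: "anchor_sec \<rho> u p f = anchor_der \<rho> u f p"
  by (simp add: anchor_der_def)

lemma anchor_der_add:
  "u \<in> sections A E \<Longrightarrow> v \<in> sections A E \<Longrightarrow> anchor_der \<rho> (u + v) f = anchor_der \<rho> u f + anchor_der \<rho> v f"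
  by (rule ext) (simp add: anchor_der_def anchor_sec_add)

lemma anchor_der_smult: "u \<in> sections A E \<Longrightarrow> anchor_der \<rho> (g \<odot> u) f = g * anchor_der \<rho> u f"
  by (rule ext) (simp add: anchor_der_def anchor_sec_smult, simp add: smult_apply scaleR_fun_def)

lemma uminus_eq_smult: "- u = (\<lambda>_. - 1) \<odot> u"
  by (rule ext) (simp add: smult_apply)

lemma anchor_der_uminus: "u \<in> sections A E \<Longrightarrow> anchor_der \<rho> (- u) f = - anchor_der \<rho> u f"
  unfolding uminus_eq_smult[of u] by (rule ext) (simp add: anchor_der_smult)

lemma anchor_der_diff:
  assumes "u \<in> sections A E" "v \<in> sections A E"
  shows "anchor_der \<rho> (u - v) f = anchor_der \<rho> u f - anchor_der \<rho> v f"
  using anchor_der_add[OF assms(1) sections_uminus[OF assms(2)], of f] by (simp add: anchor_der_uminus assms)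

lemma anchor_der_mult:
  assumes "u \<in> sections A E" "f \<in> smooth_functions A" "g \<in> smooth_functions A"
  shows "anchor_der \<rho> u (f * g) = f * anchor_der \<rho> u g + g * anchor_der \<rho> u f"
  by (rule ext) (simp add: anchor_der_def anchor_sec_def assms
      tangent_vector_mult[OF anchorD(1)[OF sectionsD(1)[OF assms(1)]]])

text \<open>Vector fields are operators on all functions, smooth or not. Fields in the image of the
  anchor give 0 on nonsmooth functions, so testing on smooth ones suffices when \<open>X\<close>
  does the same.\<close>

lemma anchor_sec_eqI:
  assumes "u \<in> sections A E" "\<And>p f. f \<in> smooth_functions A \<Longrightarrow> anchor_sec \<rho> u p f = X p f"
    and "\<And>p f. f \<notin> smooth_functions A \<Longrightarrow> X p f = 0"
  shows "anchor_sec \<rho> u = X"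
proof (intro ext)
  fix p f
  show "anchor_sec \<rho> u p f = X p f"
    using assms(2,3) tangent_vector_nonsmooth[OF anchorD(1)[OF sectionsD(1)[OF assms(1)]], of f p]
    by (cases "f \<in> smooth_functions A") (auto simp: anchor_sec_def)
qed

lemma lie_bracket_anchor:
  assumes "f \<in> smooth_functions A"
  shows "lie_bracket A (anchor_sec \<rho> u) (anchor_sec \<rho> v) p f =
    anchor_der \<rho> u (anchor_der \<rho> v f) p - anchor_der \<rho> v (anchor_der \<rho> u f) p"
  using assms by (simp add: lie_bracket_def anchor_der_def)

end

locale local_algebroid = anchored_vb A E \<rho>
  for A :: "('m::{t2_space,second_countable_topology}, 'a::real_inner) atlas"
    and E :: "('m, 'v::real_vector, 'k::real_inner) vbundle"
    and \<rho> :: "('m, 'v) anchor" +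
  fixes br :: "('m, 'v) bracket" and L :: "('m, 'v) locality"
    and P :: "('m \<Rightarrow> 'v) \<Rightarrow> 'm \<Rightarrow> 'v" and nab :: "('m, 'v) bracket"
  assumes Leibniz: "local_pre_Leibniz A E \<rho> br L"
    and projector: "locality_projector A E \<rho> L P"
    and connection: "linear_connection A E \<rho> nab"
begin

abbreviation "S \<equiv> sections A E"
abbreviation "C \<equiv> frame_contraction A E L nab"

lemma bracket:
  shows "bilinear_bracket A E br"
    and "u \<in> S \<Longrightarrow> v \<in> S \<Longrightarrow> f \<in> smooth_functions A \<Longrightarrow> br u (f \<odot> v) = anchor_der \<rho> u f \<odot> v + f \<odot> br u v"
    and "u \<in> S \<Longrightarrow> v \<in> S \<Longrightarrow> anchor_sec \<rho> (br u v) = lie_bracket A (anchor_sec \<rho> u) (anchor_sec \<rho> v)"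
    and "u \<in> S \<Longrightarrow> v \<in> S \<Longrightarrow> br u v \<in> S"
  using Leibniz
  unfolding local_pre_Leibniz_def pre_Leibniz_def almost_Leibniz_def bracket_morphism_def bilinear_bracket_def
  by blast+

lemma locality:
  shows "u \<in> S \<Longrightarrow> v \<in> S \<Longrightarrow> Cinf_linear A (one_forms A E) S (\<lambda>\<omega>. L \<omega> u v)"
    and "\<omega> \<in> one_forms A E \<Longrightarrow> v \<in> S \<Longrightarrow> Cinf_linear A S S (\<lambda>u. L \<omega> u v)"
    and "\<omega> \<in> one_forms A E \<Longrightarrow> u \<in> S \<Longrightarrow> Cinf_linear A S S (\<lambda>v. L \<omega> u v)"
    and "u \<in> S \<Longrightarrow> v \<in> S \<Longrightarrow> f \<in> smooth_functions A \<Longrightarrow>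
      br (f \<odot> u) v = - (anchor_der \<rho> v f \<odot> u) + f \<odot> br u v + L (coboundary E \<rho> f) u v"
  using Leibniz unfolding local_pre_Leibniz_def locality_operator_def by blast+

lemma L_section: "\<omega> \<in> one_forms A E \<Longrightarrow> u \<in> S \<Longrightarrow> v \<in> S \<Longrightarrow> L \<omega> u v \<in> S"
  using locality(2) unfolding Cinf_linear_def by blast

lemma L_add2: "\<omega> \<in> one_forms A E \<Longrightarrow> u \<in> S \<Longrightarrow> u' \<in> S \<Longrightarrow> v \<in> S \<Longrightarrow> L \<omega> (u + u') v = L \<omega> u v + L \<omega> u' v"
  and L_smult2: "\<omega> \<in> one_forms A E \<Longrightarrow> u \<in> S \<Longrightarrow> v \<in> S \<Longrightarrow> f \<in> smooth_functions A \<Longrightarrow>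
    L \<omega> (f \<odot> u) v = f \<odot> L \<omega> u v"
  using locality(2) unfolding Cinf_linear_def by blast+

lemma L_add3: "\<omega> \<in> one_forms A E \<Longrightarrow> u \<in> S \<Longrightarrow> v \<in> S \<Longrightarrow> v' \<in> S \<Longrightarrow> L \<omega> u (v + v') = L \<omega> u v + L \<omega> u v'"
  and L_smult3: "\<omega> \<in> one_forms A E \<Longrightarrow> u \<in> S \<Longrightarrow> v \<in> S \<Longrightarrow> f \<in> smooth_functions A \<Longrightarrow>
    L \<omega> u (f \<odot> v) = f \<odot> L \<omega> u v"
  using locality(3) unfolding Cinf_linear_def by blast+

lemma nabla:
  shows "u \<in> S \<Longrightarrow> v \<in> S \<Longrightarrow> nab u v \<in> S"
    and "u \<in> S \<Longrightarrow> rlinear_on S (\<lambda>v. nab u v)" and "v \<in> S \<Longrightarrow> rlinear_on S (\<lambda>u. nab u v)"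
    and "u \<in> S \<Longrightarrow> v \<in> S \<Longrightarrow> f \<in> smooth_functions A \<Longrightarrow> nab u (f \<odot> v) = anchor_der \<rho> u f \<odot> v + f \<odot> nab u v"
    and "u \<in> S \<Longrightarrow> v \<in> S \<Longrightarrow> f \<in> smooth_functions A \<Longrightarrow> nab (f \<odot> u) v = f \<odot> nab u v"
  using connection unfolding linear_connection_def bilinear_bracket_def by blast+

lemma proj:
  shows "Cinf_linear A S S P"
    and "\<omega> \<in> one_forms A E \<Longrightarrow> u \<in> S \<Longrightarrow> v \<in> S \<Longrightarrow> anchor_sec \<rho> (P (L \<omega> u v)) = 0"
    and "u \<in> S \<Longrightarrow> anchor_sec \<rho> u = 0 \<Longrightarrow> P u = u"
  using projector unfolding locality_projector_def by blast+

lemma P_section: "u \<in> S \<Longrightarrow> P u \<in> S"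
  and P_add: "u \<in> S \<Longrightarrow> v \<in> S \<Longrightarrow> P (u + v) = P u + P v"
  and P_smult: "u \<in> S \<Longrightarrow> f \<in> smooth_functions A \<Longrightarrow> P (f \<odot> u) = f \<odot> P u"
  using proj(1) unfolding Cinf_linear_def by blast+

section \<open>The contraction of locality operator and connection\<close>

lemma frameD:
  assumes "frame_coframe_on A E U X e" "a < vb_rank E"
  shows "X a \<in> S" "e a \<in> one_forms A E"
  using assms by (auto simp: frame_coframe_on_def)

text \<open>Expand the primed coframe and frame in the unprimed ones, using that L(\<omega>,
  \<nabla>_x u, v) is linear over smooth functions in both \<omega> and x. Summing over the primed
  index collapses the two transition matrices.\<close>

lemma contraction_frame_independent:
  assumes fr: "frame_coframe_on A E U X e" "p \<in> U" and fr': "frame_coframe_on A E U' X' e'" "p \<in> U'"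
    and uv: "u \<in> S" "v \<in> S"
  shows "(\<Sum>a<vb_rank E. L (e' a) (nab (X' a) u) v p) = (\<Sum>a<vb_rank E. L (e a) (nab (X a) u) v p)"
proof -
  let ?n = "vb_rank E"
  note X = frameD[OF fr(1)] and X' = frameD[OF fr'(1)]
  have x: "L \<omega> (nab x u) v p = (\<Sum>c<?n. e c p (x p) *\<^sub>R L \<omega> (nab (X c) u) v p)"
    if "\<omega> \<in> one_forms A E" "x \<in> S" for \<omega> x
  proof -
    have "Cinf_linear A S S (\<lambda>x. L \<omega> (nab x u) v)"
      unfolding Cinf_linear_def
      using that(1) uv rlinear_onD(1)[OF nabla(3)[OF uv(1)]]
      by (simp add: L_section nabla(1,5) L_add2 L_smult2)
    from Cinf_linear_frame[OF fr this that(2)] show ?thesis .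
  qed
  have w: "L \<omega> y v p = (\<Sum>b<?n. \<omega> p (X b p) *\<^sub>R L (e b) y v p)" if "\<omega> \<in> one_forms A E" "y \<in> S" for \<omega> y
    by (rule Cinf_linear_coframe[OF fr locality(1)[OF that(2) uv(2)] that(1)])
  \<comment> \<open>Apply \<open>e c\<close> to the expansion of X_b in the primed frame at
    \<open>p\<close>.\<close>
  have d: "(\<Sum>a<?n. e' a p (X b p) * e c p (X' a p)) = e c p (X b p)" if "b < ?n" "c < ?n" for b c
  proof -
    have "e c p (\<Sum>a<?n. e' a p (X b p) *\<^sub>R X' a p) = (\<Sum>a<?n. e' a p (X b p) *\<^sub>R e c p (X' a p))"
      by (rule rlinear_on_sum[OF one_formsD(1)[OF X(2)[OF that(2)]] subspace_fibre]) (simp add: sectionsD(1) X'(1))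
    then show ?thesis using frame_expand[OF fr' sectionsD(1)[OF X(1)[OF that(1)]]] by simp
  qed
  have "(\<Sum>a<?n. L (e' a) (nab (X' a) u) v p) =
    (\<Sum>a<?n. \<Sum>b<?n. \<Sum>c<?n. (e' a p (X b p) * e c p (X' a p)) *\<^sub>R L (e b) (nab (X c) u) v p)"
  proof (intro sum.cong refl)
    fix a assume "a \<in> {..<?n}"
    then have a: "a < ?n" by simp
    have "L (e' a) (nab (X' a) u) v p = (\<Sum>b<?n. e' a p (X b p) *\<^sub>R L (e b) (nab (X' a) u) v p)"
      by (rule w[OF X'(2)[OF a] nabla(1)[OF X'(1)[OF a] uv(1)]])
    also have "\<dots> = (\<Sum>b<?n. e' a p (X b p) *\<^sub>R (\<Sum>c<?n. e c p (X' a p) *\<^sub>R L (e b) (nab (X c) u) v p))"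
      by (intro sum.cong refl arg_cong[of _ _ "\<lambda>z. _ *\<^sub>R z"] x X(2) X'(1)[OF a]) simp
    finally show "L (e' a) (nab (X' a) u) v p =
      (\<Sum>b<?n. \<Sum>c<?n. (e' a p (X b p) * e c p (X' a p)) *\<^sub>R L (e b) (nab (X c) u) v p)"
      by (simp add: scaleR_sum_right)
  qed
  also have "\<dots> = (\<Sum>b<?n. \<Sum>c<?n. \<Sum>a<?n. (e' a p (X b p) * e c p (X' a p)) *\<^sub>R L (e b) (nab (X c) u) v p)"
    by (subst sum.swap) (intro sum.cong refl sum.swap)
  also have "\<dots> = (\<Sum>b<?n. \<Sum>c<?n. e c p (X b p) *\<^sub>R L (e b) (nab (X c) u) v p)"
    by (intro sum.cong refl) (simp add: d flip: scaleR_sum_left)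
  \<comment> \<open>The coefficients are those of X_b in its own frame, so the expansion
    \<open>x\<close> is read backwards.\<close>
  also have "\<dots> = (\<Sum>b<?n. L (e b) (nab (X b) u) v p)"
  proof (intro sum.cong refl)
    fix b assume "b \<in> {..<?n}"
    then show "(\<Sum>c<?n. e c p (X b p) *\<^sub>R L (e b) (nab (X c) u) v p) = L (e b) (nab (X b) u) v p"
      by (intro x[symmetric] X) auto
  qed
  finally show ?thesis .
qed

lemma contraction_eq:
  assumes "frame_coframe_on A E U X e" "p \<in> U" "u \<in> S" "v \<in> S"
  shows "C u v p = (\<Sum>a<vb_rank E. L (e a) (nab (X a) u) v p)"
  unfolding frame_contraction_def
proof (rule the_equality)
  fix w
  assume "\<exists>U X e. p \<in> U \<and> frame_coframe_on A E U X e \<and> w = (\<Sum>a<vb_rank E. L (e a) (nab (X a) u) v p)"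
  then obtain U' X' e' where "p \<in> U'" "frame_coframe_on A E U' X' e'"
    "w = (\<Sum>a<vb_rank E. L (e' a) (nab (X' a) u) v p)"
    by blast
  then show "w = (\<Sum>a<vb_rank E. L (e a) (nab (X a) u) v p)"
    using contraction_frame_independent[OF assms(1,2) _ _ assms(3,4)] by blast
qed (use assms in blast)

text \<open>\<open>C u v\<close> is defined pointwise with frames that vary, whereas
  \<open>P\<close> takes a global section and its kernel property is known for single values of
  \<open>L\<close>. The section \<open>t\<close> bridges the gap: a genuine finite sum of such
  values, with coefficients 1 so that linearity over sums applies.\<close>

lemma contraction_local_section:
  assumes fr: "frame_coframe_on A E U X e" and uv: "u \<in> S" "v \<in> S"
  defines "t \<equiv> \<Sum>a<vb_rank E. (\<lambda>_. 1) \<odot> L (e a) (nab (X a) u) v"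
  shows "t \<in> S" "q \<in> U \<Longrightarrow> C u v q = t q" "anchor_sec \<rho> (P t) = 0"
proof -
  let ?l = "\<lambda>a. L (e a) (nab (X a) u) v"
  have l: "\<And>a. a \<in> {..<vb_rank E} \<Longrightarrow> (\<lambda>_. 1) \<in> smooth_functions A \<and> ?l a \<in> S"
    using frameD[OF fr] uv by (simp add: L_section nabla(1) smooth_functions_const)
  show t: "t \<in> S" unfolding t_def by (rule section_module_sum[OF sections_module l])
  show "C u v q = t q" if "q \<in> U"
    using contraction_eq[OF fr that uv] by (simp add: t_def sum_fun_apply smult_apply)
  have Pt: "P t = (\<Sum>a<vb_rank E. (\<lambda>_. 1) \<odot> P (?l a))"
    unfolding t_def by (rule Cinf_linear_sum[OF proj(1) sections_module l])
  have "anchor_sec \<rho> (P t) p = 0" for p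
  proof -
    have "\<rho> p (\<Sum>a<vb_rank E. 1 *\<^sub>R P (?l a) p) = (\<Sum>a<vb_rank E. 1 *\<^sub>R \<rho> p (P (?l a) p))"
      by (rule rlinear_on_sum[OF anchorD(2) subspace_fibre]) (use l in \<open>auto intro: sectionsD(1) P_section\<close>)
    moreover have "\<rho> p (P (?l a) p) = 0" if a: "a < vb_rank E" for a
      using fun_cong[OF proj(2)[OF frameD(2)[OF fr a] nabla(1)[OF frameD(1)[OF fr a] uv(1)] uv(2)], of p]
      by (simp add: anchor_sec_def)
    ultimately show ?thesis by (simp add: Pt anchor_sec_def sum_fun_apply smult_apply)
  qed
  then show "anchor_sec \<rho> (P t) = 0" by (intro ext) simp
qed

lemma contraction_section: "u \<in> S \<Longrightarrow> v \<in> S \<Longrightarrow> C u v \<in> S"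
proof (rule sections_local)
  fix p assume uv: "u \<in> S" "v \<in> S"
  obtain W X e where W: "p \<in> W" "frame_coframe_on A E W X e" using frame_exists .
  then have "open W" by (simp add: frame_coframe_on_def)
  then show "\<exists>W t. open W \<and> p \<in> W \<and> t \<in> S \<and> (\<forall>q\<in>W. C u v q = t q)"
    using contraction_local_section[OF W(2) uv] W(1) by blast
qed

text \<open>Equality of \<open>C u v\<close> and \<open>t\<close> near a point passes through
  \<open>P\<close>, because \<open>P\<close> is local.\<close>

lemma anchor_projected_contraction:
  assumes uv: "u \<in> S" "v \<in> S"
  shows "anchor_sec \<rho> (P (C u v)) = 0"
proof
  fix p
  obtain W X e where W: "p \<in> W" "frame_coframe_on A E W X e" using frame_exists .
  note t = contraction_local_section[OF W(2) uv]
  have "open W" using W by (simp add: frame_coframe_on_def)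
  from Cinf_linear_local[OF proj(1) contraction_section[OF uv] t(1) this W(1) t(2)]
  show "anchor_sec \<rho> (P (C u v)) p = 0 p"
    using fun_cong[OF t(3), of p] by (simp add: anchor_sec_def)
qed

lemma contraction_add_left:
  assumes "u \<in> S" "u' \<in> S" "v \<in> S"
  shows "C (u + u') v = C u v + C u' v"
proof
  fix p
  obtain W X e where W: "p \<in> W" "frame_coframe_on A E W X e" using frame_exists .
  have "L (e a) (nab (X a) (u + u')) v = L (e a) (nab (X a) u) v + L (e a) (nab (X a) u') v"
    if "a < vb_rank E" for a
    using frameD[OF W(2) that] assms by (simp add: rlinear_onD(1)[OF nabla(2)] L_add2 nabla(1))
  then show "C (u + u') v p = (C u v + C u' v) p"
    using assms by (simp add: contraction_eq[OF W(2,1)] sections_add sum.distrib)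
qed

lemma contraction_add_right:
  assumes "u \<in> S" "v \<in> S" "v' \<in> S"
  shows "C u (v + v') = C u v + C u v'"
proof
  fix p
  obtain W X e where W: "p \<in> W" "frame_coframe_on A E W X e" using frame_exists .
  have "L (e a) (nab (X a) u) (v + v') = L (e a) (nab (X a) u) v + L (e a) (nab (X a) u) v'"
    if "a < vb_rank E" for a
    using frameD[OF W(2) that] assms by (simp add: L_add3 nabla(1))
  then show "C u (v + v') p = (C u v + C u v') p"
    using assms by (simp add: contraction_eq[OF W(2,1)] sections_add sum.distrib)
qed

lemma contraction_smult_right:
  assumes "u \<in> S" "v \<in> S" "f \<in> smooth_functions A"
  shows "C u (f \<odot> v) = f \<odot> C u v"
proof
  fix p
  obtain W X e where W: "p \<in> W" "frame_coframe_on A E W X e" using frame_exists .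
  have "L (e a) (nab (X a) u) (f \<odot> v) = f \<odot> L (e a) (nab (X a) u) v" if "a < vb_rank E" for a
    using frameD[OF W(2) that] assms by (simp add: L_smult3 nabla(1))
  then show "C u (f \<odot> v) p = (f \<odot> C u v) p"
    using assms by (simp add: contraction_eq[OF W(2,1)] sections_smult smult_apply scaleR_sum_right)
qed

text \<open>The derivative term comes from \<open>\<rho>(X\<^sub>a)(f) e\<^sup>a = Df\<close>.\<close>

lemma contraction_smult_left:
  assumes uv: "u \<in> S" "v \<in> S" and f: "f \<in> smooth_functions A"
  shows "C (f \<odot> u) v = f \<odot> C u v + L (coboundary E \<rho> f) u v"
proof
  fix p
  let ?n = "vb_rank E"
  obtain W X e where W: "p \<in> W" "frame_coframe_on A E W X e" using frame_exists .
  note X = frameD[OF W(2)]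
  have "L (e a) (nab (X a) (f \<odot> u)) v = anchor_der \<rho> (X a) f \<odot> L (e a) u v + f \<odot> L (e a) (nab (X a) u) v"
    if "a < ?n" for a
    using X[OF that] uv f
    by (simp add: nabla(1,4) L_add2 L_smult2 sections_smult anchor_der_smooth)
  then have "C (f \<odot> u) v p = (\<Sum>a<?n. anchor_der \<rho> (X a) f p *\<^sub>R L (e a) u v p) + f p *\<^sub>R C u v p"
    using uv f by (simp add: contraction_eq[OF W(2,1)] sections_smult smult_apply scaleR_sum_right sum.distrib)
  also have "(\<Sum>a<?n. anchor_der \<rho> (X a) f p *\<^sub>R L (e a) u v p) =
    (\<Sum>a<?n. coboundary E \<rho> f p (X a p) *\<^sub>R L (e a) u v p)"
    by (intro sum.cong refl) (simp add: coboundary_def anchor_der_def anchor_sec_def sectionsD(1)[OF X(1)])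
  also have "\<dots> = L (coboundary E \<rho> f) u v p"
    by (rule Cinf_linear_coframe[OF W(2,1) locality(1)[OF uv] coboundary_one_form[OF f], symmetric])
  finally show "C (f \<odot> u) v p = (f \<odot> C u v + L (coboundary E \<rho> f) u v) p"
    by (simp add: smult_apply[of f "C u v"] add.commute)
qed

text \<open>The morphism property of the bracket, read as a commutator of derivations.\<close>

lemma anchor_der_bracket:
  "u \<in> S \<Longrightarrow> v \<in> S \<Longrightarrow> f \<in> smooth_functions A \<Longrightarrow>
    anchor_der \<rho> (br u v) f p = anchor_der \<rho> u (anchor_der \<rho> v f) p - anchor_der \<rho> v (anchor_der \<rho> u f) p"
  by (simp add: lie_bracket_anchor bracket(3) flip: anchor_der_sec)

text \<open>Apply \<open>\<rho>\<close> to the locality equation for \<open>[fu, v]\<close>: all other terms cancel.\<close>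

lemma projector_coboundary:
  assumes uv: "u \<in> S" "v \<in> S" and f: "f \<in> smooth_functions A"
  shows "P (L (coboundary E \<rho> f) u v) = L (coboundary E \<rho> f) u v"
proof (rule proj(3))
  let ?l = "L (coboundary E \<rho> f) u v"
  show l: "?l \<in> S" by (rule L_section[OF coboundary_one_form[OF f] uv])
  show "anchor_sec \<rho> ?l = 0"
  proof (rule anchor_sec_eqI[OF l])
    fix p g assume g: "g \<in> smooth_functions A"
    have s: "anchor_der \<rho> v f \<odot> u \<in> S" "- (anchor_der \<rho> v f \<odot> u) \<in> S" "f \<odot> br u v \<in> S" "br u v \<in> S"
      "f \<odot> u \<in> S" "- (anchor_der \<rho> v f \<odot> u) + f \<odot> br u v \<in> S"
      using uv f by (simp_all add: sections_smult sections_uminus sections_add sections_diff anchor_der_smooth bracket(4))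
    have "anchor_der \<rho> (br (f \<odot> u) v) g p =
      - (anchor_der \<rho> v f p * anchor_der \<rho> u g p) + f p * anchor_der \<rho> (br u v) g p + anchor_der \<rho> ?l g p"
      using s l uv by (simp add: locality(4)[OF uv f] anchor_der_add anchor_der_diff anchor_der_smult)
    \<comment> \<open>A second evaluation, from the morphism property alone: the product rule for
      \<rho>(v) applied to f \<rho>(u)(g) yields the same anomalous term.\<close>
    moreover have "anchor_der \<rho> (br (f \<odot> u) v) g p =
      f p * anchor_der \<rho> (br u v) g p - anchor_der \<rho> u g p * anchor_der \<rho> v f p"
      using s uv f g
      by (simp add: anchor_der_bracket anchor_der_smult anchor_der_mult anchor_der_smooth algebra_simps)
    ultimately show "anchor_sec \<rho> ?l p g = 0 p g" by (simp add: anchor_der_sec)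
  qed simp
qed

section \<open>The modified bracket\<close>

abbreviation "mbr \<equiv> modified_bracket A E br L P nab"

lemma modified_section: "u \<in> S \<Longrightarrow> v \<in> S \<Longrightarrow> mbr u v \<in> S"
  by (simp add: modified_bracket_def sections_diff bracket(4) P_section contraction_section)

text \<open>Real scalars are constant smooth functions, so real homogeneity becomes a case of
  linearity over smooth functions.\<close>

lemma scaleR_eq_smult: "c *\<^sub>R u = (\<lambda>_. c) \<odot> u"
  by (simp add: smult_def scaleR_fun_def)

text \<open>Pull \<open>g\<close> out of the second slot first: the bracket obeys the Leibniz rule
  there and \<open>C\<close> is linear. What remains concerns \<open>f\<close> alone, and both
  \<open>br\<close> and \<open>P\<close> after \<open>C\<close> contribute the same term g
  L(Df,u,v), which drops out of the difference.\<close>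

lemma modified_dull:
  assumes uv: "u \<in> S" "v \<in> S" and f: "f \<in> smooth_functions A" "g \<in> smooth_functions A"
  shows "mbr (f \<odot> u) (g \<odot> v) =
    (f * g) \<odot> mbr u v + (f * anchor_der \<rho> u g) \<odot> v - (g * anchor_der \<rho> v f) \<odot> u"
proof -
  let ?l = "L (coboundary E \<rho> f) u v"
  have s: "f \<odot> u \<in> S" "g \<odot> v \<in> S" "C u v \<in> S" "?l \<in> S" "f \<odot> C u v \<in> S" "f \<odot> C u v + ?l \<in> S"
    using uv f by (simp_all add: sections_smult sections_add contraction_section L_section coboundary_one_form)
  have "br (f \<odot> u) (g \<odot> v) =
    (f * anchor_der \<rho> u g) \<odot> v + g \<odot> (- (anchor_der \<rho> v f \<odot> u) + f \<odot> br u v + ?l)"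
    using s uv f by (simp add: bracket(2) locality(4) anchor_der_smult)
  moreover have "P (C (f \<odot> u) (g \<odot> v)) = g \<odot> (f \<odot> P (C u v) + ?l)"
    using s uv f
    by (simp add: contraction_smult_right contraction_smult_left P_smult P_add projector_coboundary)
  ultimately show ?thesis
    by (intro ext) (simp add: modified_bracket_def smult_apply algebra_simps)
qed

lemma modified_bilinear: "bilinear_bracket A E mbr"
  unfolding bilinear_bracket_def
proof (intro conjI ballI)
  note b = bracket(1)[unfolded bilinear_bracket_def]
  have br_add: "br u (v + v') = br u v + br u v'" "br (v + v') u = br v u + br v' u"
    if "u \<in> S" "v \<in> S" "v' \<in> S" for u v v'
    using b that rlinear_onD(1) by blast+
  show "mbr u v \<in> S" if "u \<in> S" "v \<in> S" for u v by (rule modified_section[OF that])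
  show "rlinear_on S (mbr u)" if u: "u \<in> S" for u
    unfolding rlinear_on_def
  proof (intro conjI ballI allI)
    show "mbr u (v + v') = mbr u v + mbr u v'" if "v \<in> S" "v' \<in> S" for v v'
      using u that
      by (simp add: modified_bracket_def br_add contraction_add_right P_add contraction_section)
    show "mbr u (c *\<^sub>R v) = c *\<^sub>R mbr u v" if v: "v \<in> S" for c v
    proof -
      have "br u (c *\<^sub>R v) = c *\<^sub>R br u v" using b u v rlinear_onD(2) by blast
      moreover have "P (C u (c *\<^sub>R v)) = c *\<^sub>R P (C u v)"
        using u v by (simp add: scaleR_eq_smult contraction_smult_right P_smult contraction_section smooth_functions_const)
      ultimately show ?thesis by (simp add: modified_bracket_def scaleR_diff_right)
    qed
  qed
  show "rlinear_on S (\<lambda>u. mbr u v)" if v: "v \<in> S" for v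
    unfolding rlinear_on_def
  proof (intro conjI ballI allI)
    show "mbr (u + u') v = mbr u v + mbr u' v" if "u \<in> S" "u' \<in> S" for u u'
      using v that
      by (simp add: modified_bracket_def br_add contraction_add_left P_add contraction_section)
    show "mbr (c *\<^sub>R u) v = c *\<^sub>R mbr u v" if u: "u \<in> S" for c u
    proof -
      have c: "(\<lambda>_. c) \<in> smooth_functions A" by (rule smooth_functions_const)
      \<comment> \<open>The rule for a smooth factor in the first slot would leave L(Dc,u,v); real
        linearity of the connection in that argument avoids this term.\<close>
      have "C (c *\<^sub>R u) v = c *\<^sub>R C u v"
      proof
        fix p
        obtain W X e where W: "p \<in> W" "frame_coframe_on A E W X e" using frame_exists .
        have "L (e a) (nab (X a) (c *\<^sub>R u)) v = c *\<^sub>R L (e a) (nab (X a) u) v" if "a < vb_rank E" for a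
        proof -
          note X = frameD[OF W(2) that]
          have "nab (X a) (c *\<^sub>R u) = (\<lambda>_. c) \<odot> nab (X a) u"
            using rlinear_onD(2)[OF nabla(2)[OF X(1)] u] by (simp add: scaleR_eq_smult)
          then show ?thesis
            using L_smult2[OF X(2) nabla(1)[OF X(1) u] v c] by (simp add: scaleR_eq_smult)
        qed
        moreover have "c *\<^sub>R u \<in> S" using sections_smult[OF c u] by (simp add: scaleR_eq_smult)
        ultimately show "C (c *\<^sub>R u) v p = (c *\<^sub>R C u v) p"
          using u v by (simp add: contraction_eq[OF W(2,1)] scaleR_fun_def scaleR_sum_right)
      qed
      then have "P (C (c *\<^sub>R u) v) = c *\<^sub>R P (C u v)"
        using P_smult[OF contraction_section[OF u v] c] by (simp add: scaleR_eq_smult)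
      moreover have "br (c *\<^sub>R u) v = c *\<^sub>R br u v" using b u v rlinear_onD(2) by blast
      ultimately show ?thesis by (simp add: modified_bracket_def scaleR_diff_right)
    qed
  qed
qed

lemma modified_morphism: "bracket_morphism A E \<rho> mbr"
  unfolding bracket_morphism_def
proof (intro ballI)
  fix u v assume uv: "u \<in> S" "v \<in> S"
  have "br u v = mbr u v + P (C u v)" by (simp add: modified_bracket_def)
  then have "anchor_sec \<rho> (br u v) = anchor_sec \<rho> (mbr u v) + anchor_sec \<rho> (P (C u v))"
    using anchor_sec_add[OF modified_section[OF uv] P_section[OF contraction_section[OF uv]]] by simp
  then show "anchor_sec \<rho> (mbr u v) = lie_bracket A (anchor_sec \<rho> u) (anchor_sec \<rho> v)"
    using anchor_projected_contraction[OF uv] bracket(3)[OF uv] by simp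
qed

lemma anchored: "anchored_bundle A E \<rho>"
  using mfd vb anchor by (simp add: anchored_bundle_def)

lemma modified_pre_dull: "pre_dull A E \<rho> mbr"
  unfolding pre_dull_def almost_dull_def
  using anchored modified_bilinear modified_morphism modified_dull by blast

lemma modified_pre_Leibniz: "pre_Leibniz A E \<rho> mbr"
  unfolding pre_Leibniz_def almost_Leibniz_def
proof (intro conjI ballI anchored modified_bilinear modified_morphism)
  fix u v f assume uv: "u \<in> S" "v \<in> S" and f: "f \<in> smooth_functions A"
  have one: "(\<lambda>_. 1) \<in> smooth_functions A" by (rule smooth_functions_const)
  have "(\<lambda>_. 1) \<odot> u = u" by (simp add: smult_def)
  with modified_dull[OF uv one f] have "mbr u (f \<odot> v) = ((\<lambda>_. 1) * f) \<odot> mbr u v +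
      ((\<lambda>_. 1) * anchor_der \<rho> u f) \<odot> v - (f * anchor_der \<rho> v (\<lambda>_. 1)) \<odot> u"
    by simp
  \<comment> \<open>The Leibniz rule is the dull rule with first factor 1, up to the derivative of
    1; the product rule for 1 = 1 * 1 shows that this is 0.\<close>
  moreover have "anchor_der \<rho> v (\<lambda>_. 1) = 0"
    using anchor_der_mult[OF uv(2) one one] by (simp add: times_fun_def plus_fun_def fun_eq_iff)
  ultimately show "mbr u (f \<odot> v) = anchor_der \<rho> u f \<odot> v + f \<odot> mbr u v"
    by (intro ext) (simp add: smult_apply)
qed

text \<open>The anchor sends [u,v] + [v,u] to the sum of the two opposite Lie brackets, which is 0;
  so \<open>P\<close> fixes it, and admissibility identifies it with the projected symmetric part of
  the contraction.\<close>

lemma modified_antisym: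
  assumes adm: "admissible_connection A E br L nab" and uv: "u \<in> S" "v \<in> S"
  shows "mbr u v = - mbr v u"
proof -
  let ?s = "br u v + br v u"
  have s: "?s = C u v + C v u" using adm uv by (simp add: admissible_connection_def)
  have m: "?s \<in> S" by (intro sections_add bracket(4) uv)
  have "anchor_sec \<rho> ?s = 0"
  proof (rule anchor_sec_eqI[OF m])
    fix p f assume "f \<in> smooth_functions A"
    then show "anchor_sec \<rho> ?s p f = 0 p f"
      using uv by (simp add: anchor_sec_add bracket(3,4) lie_bracket_anchor)
  qed simp
  then have "P ?s = ?s" using proj(3)[OF m] by simp
  then have "P (C u v) + P (C v u) = ?s"
    using P_add[OF contraction_section[OF uv] contraction_section[OF uv(2,1)]] s by simp
  then have "mbr u v + mbr v u = 0" by (simp add: modified_bracket_def algebra_simps)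
  then show ?thesis by (rule eq_neg_iff_add_eq_0[THEN iffD2])
qed

end

theorem proposition3p4:
  fixes A :: "('m::{t2_space,second_countable_topology}, 'a::real_inner) atlas"
    and E :: "('m, 'v::real_vector, 'k::real_inner) vbundle"
    and \<rho> :: "('m, 'v) anchor"
    and br :: "('m, 'v) bracket"
    and L :: "('m, 'v) locality"
    and P :: "('m \<Rightarrow> 'v) \<Rightarrow> 'm \<Rightarrow> 'v"
    and nab :: "('m, 'v) bracket"
  assumes "local_pre_Leibniz A E \<rho> br L"
    and "regular_anchor E \<rho>"
    and "locality_projector A E \<rho> L P"
    and "linear_connection A E \<rho> nab"
  shows "pre_dull A E \<rho> (modified_bracket A E br L P nab) \<and>
    (admissible_connection A E br L nab \<longrightarrow> pre_Lie A E \<rho> (modified_bracket A E br L P nab))"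
proof -
  have "smooth_manifold A" "vector_bundle A E" "vb_morphism A E (tangent_bundle A) \<rho>"
    using assms(1)
    by (simp_all add: local_pre_Leibniz_def pre_Leibniz_def almost_Leibniz_def anchored_bundle_def)
  then interpret local_algebroid A E \<rho> br L P nab
    using assms(1,3,4) by unfold_locales
  show ?thesis
    unfolding pre_Lie_def
    by (intro conjI impI ballI modified_pre_dull modified_pre_Leibniz) (rule modified_antisym)
qed

end
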